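(* Let $G$ be a connected graph and let $A, B$ be two disjoint, linked and saturated subsets of $V(G)$. Then whether $A$ and $B$ can be separated by half-spaces can be decided in time polynomial in the size of $G$.
   Context: All graphs are finite, undirected and loopless. For $X \subseteq V(G)$, $N(X) = \{u \in V(G)\setminus X : u \text{ adjacent to some } x \in X\}$. A chordless $uv$-path is a $uv$-path that is an induced subgraph. A set $C \subseteq V(G)$ is convex if for all $u,v \in C$ every vertex on a chordless $uv$-path lies in $C$; $\mathrm{cl}(X)$ is the intersection of all convex sets containing $X$. A half-space is a convex set $H$ with $V(G)\setminus H$ convex; $A$ and $B$ are separated by half-spaces if there is a half-space $H$ with $A \subseteq H$ and $B \subseteq V(G)\setminus H$. $A,B$ are linked if some vertex of $A$ is adjacent to some vertex of $B$. The shadow is $A/B = \{v : \mathrm{cl}(B\cup\{v\})\cap A \neq\emptyset\}$. A set $X \subseteq V(G)\setminus(A\cup B)$ is forbidden if $\mathrm{cl}(X)$ meets both $A$ and $B$; $\mathrm{mfs}(A,B)$ is the family of inclusion-minimal forbidden sets. $\sigma(A,B) = \mathrm{cl}\big(A/B \cup \bigcup\{\bigcap_{x\in X}\mathrm{cl}(A\cup\{x\}) : X \in \mathrm{mfs}(A,B)\}\big)$; $S(A,B) = \bigcup_{i \ge 0}\sigma(A_i,B_i)$ with $A_0 = A$, $B_0 = B$, $A_i = \sigma(A_{i-1},B_{i-1})$, $B_i = \sigma(B_{i-1},A_{i-1})$; $A,B$ are saturated if $A = S(A,B)$ and $B = S(B,A)$. *)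

theory Defs
  imports "Graph_Theory.Graph_Theory" "HOL-Computational_Algebra.Polynomial"
begin

section \<open>Monophonic convexity and half-spaces\<close>

text \<open>
  A finite simple graph is a \<^const>\<open>pair_graph\<close>: every edge is present as two opposite arcs.
\<close>

text \<open>
  The path is given by its vertices; the arcs of \<open>G\<close> induced by them have to be exactly the path
  edges, each in both directions.  The one-vertex path is allowed.
\<close>

definition chordless_path :: "'a pair_pre_digraph \<Rightarrow> 'a \<Rightarrow> 'a list \<Rightarrow> 'a \<Rightarrow> bool" where
  "chordless_path G u p v \<longleftrightarrow>
     vpath p (with_proj G) \<and> hd p = u \<and> last p = v \<and>
     arcs (with_proj G \<restriction> set p) = set (vwalk_arcs p) \<union> (set (vwalk_arcs p))\<inverse>"

definition convex :: "'a pair_pre_digraph \<Rightarrow> 'a set \<Rightarrow> bool" where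
  "convex G C \<longleftrightarrow>
     C \<subseteq> pverts G \<and> (\<forall>u\<in>C. \<forall>v\<in>C. \<forall>p. chordless_path G u p v \<longrightarrow> set p \<subseteq> C)"

definition cl :: "'a pair_pre_digraph \<Rightarrow> 'a set \<Rightarrow> 'a set" where
  "cl G X = \<Inter>{C. convex G C \<and> X \<subseteq> C}"

definition half_space :: "'a pair_pre_digraph \<Rightarrow> 'a set \<Rightarrow> bool" where
  "half_space G H \<longleftrightarrow> convex G H \<and> convex G (pverts G - H)"

definition separated_by_half_spaces :: "'a pair_pre_digraph \<Rightarrow> 'a set \<Rightarrow> 'a set \<Rightarrow> bool" where
  "separated_by_half_spaces G A B \<longleftrightarrow> (\<exists>H. half_space G H \<and> A \<subseteq> H \<and> B \<subseteq> pverts G - H)"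

definition linked :: "'a pair_pre_digraph \<Rightarrow> 'a set \<Rightarrow> 'a set \<Rightarrow> bool" where
  "linked G A B \<longleftrightarrow> (\<exists>a\<in>A. \<exists>b\<in>B. (a, b) \<in> parcs G)"

definition shadow :: "'a pair_pre_digraph \<Rightarrow> 'a set \<Rightarrow> 'a set \<Rightarrow> 'a set" where
  "shadow G A B = {v \<in> pverts G. cl G (B \<union> {v}) \<inter> A \<noteq> {}}"

definition forbidden :: "'a pair_pre_digraph \<Rightarrow> 'a set \<Rightarrow> 'a set \<Rightarrow> 'a set \<Rightarrow> bool" where
  "forbidden G A B X \<longleftrightarrow>
     X \<subseteq> pverts G - (A \<union> B) \<and> cl G X \<inter> A \<noteq> {} \<and> cl G X \<inter> B \<noteq> {}"

definition mfs :: "'a pair_pre_digraph \<Rightarrow> 'a set \<Rightarrow> 'a set \<Rightarrow> 'a set set" where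
  "mfs G A B = {X. forbidden G A B X \<and> (\<forall>Y. Y \<subset> X \<longrightarrow> \<not> forbidden G A B Y)}"

definition sigma :: "'a pair_pre_digraph \<Rightarrow> 'a set \<Rightarrow> 'a set \<Rightarrow> 'a set" where
  "sigma G A B =
     cl G (shadow G A B \<union> \<Union>{\<Inter>x\<in>X. cl G (A \<union> {x}) | X. X \<in> mfs G A B})"

primrec sigma_iter :: "'a pair_pre_digraph \<Rightarrow> 'a set \<Rightarrow> 'a set \<Rightarrow> nat \<Rightarrow> 'a set \<times> 'a set" where
  "sigma_iter G A B 0 = (A, B)"
| "sigma_iter G A B (Suc i) =
     (let (A', B') = sigma_iter G A B i in (sigma G A' B', sigma G B' A'))"

definition saturation :: "'a pair_pre_digraph \<Rightarrow> 'a set \<Rightarrow> 'a set \<Rightarrow> 'a set" where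
  "saturation G A B = (\<Union>i. sigma G (fst (sigma_iter G A B i)) (snd (sigma_iter G A B i)))"

definition saturated :: "'a pair_pre_digraph \<Rightarrow> 'a set \<Rightarrow> 'a set \<Rightarrow> bool" where
  "saturated G A B \<longleftrightarrow> A = saturation G A B \<and> B = saturation G B A"


section \<open>Polynomial-time decidability\<close>

text \<open>
  The machine model is a structured random access machine over natural numbers with addition and
  truncated subtraction, but no multiplication, as primitive operations.  Every operation has unit
  cost.  In \<open>t\<close> steps the bit length of the stored numbers grows by at most \<open>O(t)\<close>, so this model
  is polynomially equivalent to Turing machines (Cook and Reckhow, 1973).

  The memory consists of arrays: \<open>s a i\<close> is cell \<open>i\<close> of array \<open>a\<close>.  Array names are constants of
  the program, so that a program uses finitely many arrays; these could equally be interleaved in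
  a single memory.  Cell indices are computed, which gives indirect addressing.
\<close>

type_synonym state = "nat \<Rightarrow> nat \<Rightarrow> nat"

datatype exp = Const nat | Cell nat exp | Add exp exp | Sub exp exp

primrec val :: "exp \<Rightarrow> state \<Rightarrow> nat" where
  "val (Const k) s = k"
| "val (Cell a e) s = s a (val e s)"
| "val (Add e f) s = val e s + val f s"
| "val (Sub e f) s = val e s - val f s"

primrec cost :: "exp \<Rightarrow> nat" where
  "cost (Const k) = 1"
| "cost (Cell a e) = 1 + cost e"
| "cost (Add e f) = 1 + cost e + cost f"
| "cost (Sub e f) = 1 + cost e + cost f"

datatype com = Skip | Assign nat exp exp | Seq com com | If exp com com | While exp com

text \<open>
  \<open>exec c s t s'\<close>: started in memory \<open>s\<close>, the program \<open>c\<close> halts after \<open>t\<close> steps with memory \<open>s'\<close>.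
  A test succeeds if its value is nonzero.
\<close>

inductive exec :: "com \<Rightarrow> state \<Rightarrow> nat \<Rightarrow> state \<Rightarrow> bool" where
  Skip: "exec Skip s 1 s"
| Assign: "exec (Assign a i e) s (1 + cost i + cost e) (s(a := (s a)(val i s := val e s)))"
| Seq: "exec c s t s' \<Longrightarrow> exec d s' t' s'' \<Longrightarrow> exec (Seq c d) s (t + t') s''"
| IfTrue: "val b s \<noteq> 0 \<Longrightarrow> exec c s t s' \<Longrightarrow> exec (If b c d) s (1 + cost b + t) s'"
| IfFalse: "val b s = 0 \<Longrightarrow> exec d s t s' \<Longrightarrow> exec (If b c d) s (1 + cost b + t) s'"
| WhileFalse: "val b s = 0 \<Longrightarrow> exec (While b c) s (1 + cost b) s"
| WhileTrue: "val b s \<noteq> 0 \<Longrightarrow> exec c s t s' \<Longrightarrow> exec (While b c) s' t' s'' \<Longrightarrow>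
    exec (While b c) s (1 + cost b + t + t') s''"

inductive_cases exec_SkipE: "exec Skip s t s'"
inductive_cases exec_AssignE: "exec (Assign a i e) s t s'"
inductive_cases exec_SeqE: "exec (Seq c d) s t s'"
inductive_cases exec_IfE: "exec (If b c d) s t s'"
inductive_cases exec_WhileE: "exec (While b c) s t s'"

lemma exec_deterministic:
  "exec c s t s' \<Longrightarrow> exec c s u s'' \<Longrightarrow> u = t \<and> s'' = s'"
proof (induction arbitrary: u s'' rule: exec.induct)
  case (Skip s)
  then show ?case by (rule exec_SkipE) simp
next
  case (Assign a i e s)
  then show ?case by (rule exec_AssignE) simp
next
  case (Seq c s t s' d t' r)
  from Seq.prems obtain u1 r1 u2
    where 1: "exec c s u1 r1" and 2: "exec d r1 u2 s''" and u: "u = u1 + u2" by (rule exec_SeqE)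
  from Seq.IH(1)[OF 1] have *: "u1 = t" "r1 = s'" by blast+
  from Seq.IH(2)[OF 2[unfolded *]] show ?case unfolding u * by blast
next
  case (IfTrue b s c t s' d)
  from IfTrue.prems obtain u1 where 1: "exec c s u1 s''" and u: "u = 1 + cost b + u1"
    by (rule exec_IfE) (use IfTrue.hyps(1) in simp_all)
  from IfTrue.IH[OF 1] show ?case unfolding u by blast
next
  case (IfFalse b s d t s' c)
  from IfFalse.prems obtain u1 where 1: "exec d s u1 s''" and u: "u = 1 + cost b + u1"
    by (rule exec_IfE) (use IfFalse.hyps(1) in simp_all)
  from IfFalse.IH[OF 1] show ?case unfolding u by blast
next
  case (WhileFalse b s c)
  from WhileFalse.prems show ?case
    by (rule exec_WhileE) (use WhileFalse.hyps in simp_all)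
next
  case (WhileTrue b s c t s' t' r)
  from WhileTrue.prems obtain u1 r1 u2
    where 1: "exec c s u1 r1" and 2: "exec (While b c) r1 u2 s''"
      and u: "u = 1 + cost b + u1 + u2"
    by (rule exec_WhileE) (use WhileTrue.hyps(1) in simp_all)
  from WhileTrue.IH(1)[OF 1] have *: "u1 = t" "r1 = s'" by blast+
  from WhileTrue.IH(2)[OF 2[unfolded *]] show ?case unfolding u * by blast
qed

text \<open>
  The decision problem \<open>Q\<close> restricted to the instances satisfying the promise \<open>P\<close>.  A single
  program handles all instances; its answer is cell 0 of array 0, nonzero meaning yes.
  \<open>enc x\<close> is the initial memory for the instance \<open>x\<close>.
\<close>

definition poly_time_decidable ::
    "('i \<Rightarrow> nat) \<Rightarrow> ('i \<Rightarrow> state) \<Rightarrow> ('i \<Rightarrow> bool) \<Rightarrow> ('i \<Rightarrow> bool) \<Rightarrow> bool" where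
  "poly_time_decidable sz enc P Q \<longleftrightarrow>
     (\<exists>c (p :: nat poly). \<forall>x. P x \<longrightarrow>
        (\<exists>t s. exec c (enc x) t s \<and> t \<le> poly p (sz x) \<and> (s 0 0 \<noteq> 0 \<longleftrightarrow> Q x)))"

text \<open>
  As an input, a graph has its \<open>n\<close> vertices numbered \<open>0, \<dots>, n - 1\<close>.  Cell 0 of array 0 holds
  \<open>n\<close>, array 1 the adjacency matrix row by row, arrays 2 and 3 the characteristic vectors of the
  two vertex sets.  All other cells are 0.
\<close>

definition numbered :: "nat pair_pre_digraph \<Rightarrow> bool" where
  "numbered G \<longleftrightarrow> pverts G = {..<card (pverts G)}"

fun encode :: "nat pair_pre_digraph \<times> nat set \<times> nat set \<Rightarrow> state" where
  "encode (G, A, B) = (let n = card (pverts G) in (\<lambda>a i.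
     if a = 0 then (if i = 0 then n else 0)
     else if a = 1 then of_bool (i < n * n \<and> (i div n, i mod n) \<in> parcs G)
     else if a = 2 then of_bool (i \<in> A)
     else if a = 3 then of_bool (i \<in> B)
     else 0))"

definition graph_size :: "nat pair_pre_digraph \<Rightarrow> nat" where
  "graph_size G = card (pverts G) + card (parcs G)"

end

theory Submission
  imports Defs
begin

text \<open>
  In a connected graph, \<open>H\<close> is a half-space iff the vertices of \<open>H\<close> with a neighbour outside \<open>H\<close>
  form a clique, and so do the vertices outside \<open>H\<close> with a neighbour in \<open>H\<close>: a chordless path that
  leaves \<open>H\<close> and returns to it does so at nonadjacent vertices, and conversely two nonadjacent
  boundary vertices are joined by a chordless path through the (connected) other side.

  Let \<open>ab\<close> be an edge with \<open>a \<in> A\<close> and \<open>b \<in> B\<close>.  It is a cut edge, so every cut edge \<open>xy\<close> has \<open>x\<close> in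
  the closed neighbourhood of \<open>a\<close> and \<open>y\<close> in that of \<open>b\<close>.  Hence the neighbours of exactly one of \<open>a\<close>,
  \<open>b\<close> have a known side, while every common neighbour is a boundary vertex whichever side it is on.
  This turns the clique conditions into conflicts between pairs of decisions, which is an instance
  of 2-SAT.  It is solved by eliminating the variables one at a time by resolution; only clauses
  with at most two literals occur, so they fit into a matrix.
\<close>

section \<open>Half-spaces and clique boundaries\<close>

lemma set_vwalk_arcs_conv_nth:
  "set (vwalk_arcs p) = {(p ! i, p ! Suc i) |i. Suc i < length p}"
proof (induction p rule: vwalk_arcs.induct)
  case (3 x y xs)
  have "{((x # y # xs) ! i, (x # y # xs) ! Suc i) |i. Suc i < length (x # y # xs)}
      = insert (x, y) {((y # xs) ! i, (y # xs) ! Suc i) |i. Suc i < length (y # xs)}"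
    (is "?A = ?B")
  proof (intro equalityI subsetI)
    fix e assume "e \<in> ?A"
    then obtain i where i: "e = ((x # y # xs) ! i, (x # y # xs) ! Suc i)" "Suc i < length (x # y # xs)"
      by blast
    then show "e \<in> ?B" by (cases i) auto
  next
    fix e assume "e \<in> ?B"
    then consider "e = (x, y)" | i where "e = ((y # xs) ! i, (y # xs) ! Suc i)" "Suc i < length (y # xs)"
      by blast
    then show "e \<in> ?A"
    proof cases
      case 1 then show ?thesis by (auto intro: exI[of _ 0])
    next
      case 2 then show ?thesis by (auto intro: exI[of _ "Suc i"])
    qed
  qed
  then show ?case using 3 by simp
qed auto

section \<open>Chordless paths: a description by positions, and their existence inside walks\<close>

context pair_graph
begin

text \<open>Arcs are symmetric and loops are absent, so the induced arcs are determined by pairs of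
  positions \<open>i < j\<close>.\<close>

lemma chordless_path_conv_nth:
  "chordless_path G u p v \<longleftrightarrow> p \<noteq> [] \<and> set p \<subseteq> pverts G \<and> distinct p \<and> hd p = u \<and> last p = v \<and>
     (\<forall>i j. i < j \<longrightarrow> j < length p \<longrightarrow> (p ! i, p ! j) \<in> parcs G \<longleftrightarrow> j = Suc i)"
  (is "?L \<longleftrightarrow> ?R")
proof
  assume L: ?L
  have d: "distinct p" using L by (auto simp: chordless_path_def vpath_def)
  have arcs: "{e \<in> parcs G. fst e \<in> set p \<and> snd e \<in> set p} =
      set (vwalk_arcs p) \<union> (set (vwalk_arcs p))\<inverse>"
    using L by (auto simp: chordless_path_def)
  have "(p ! i, p ! j) \<in> parcs G \<longleftrightarrow> j = Suc i" if "i < j" "j < length p" for i j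
  proof -
    have "(p ! i, p ! j) \<in> parcs G \<longleftrightarrow> (p ! i, p ! j) \<in> set (vwalk_arcs p) \<union> (set (vwalk_arcs p))\<inverse>"
      unfolding arcs[symmetric] using that by auto
    also have "\<dots> \<longleftrightarrow> j = Suc i"
      using that d by (auto simp: set_vwalk_arcs_conv_nth nth_eq_iff_index_eq)
    finally show ?thesis .
  qed
  then show ?R using L by (auto simp: chordless_path_def vpath_def vwalk_def)
next
  assume R: ?R
  have step: "(p ! i, p ! Suc i) \<in> parcs G" if "Suc i < length p" for i
    using R that by auto
  have "e \<in> set (vwalk_arcs p) \<union> (set (vwalk_arcs p))\<inverse>"
    if e: "e \<in> parcs G" "fst e \<in> set p" "snd e \<in> set p" for e
  proof -
    obtain i j where ij: "i < length p" "j < length p" "e = (p ! i, p ! j)"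
      using e by (metis in_set_conv_nth prod.collapse)
    have "i \<noteq> j" using e(1) ij(3) no_loops' by blast
    moreover have "(p ! j, p ! i) \<in> parcs G" using e(1) ij(3) arcs_symmetric by blast
    ultimately have "j = Suc i \<or> i = Suc j"
      using R e(1) ij by (metis nat_neq_iff)
    then show ?thesis using ij by (auto simp: set_vwalk_arcs_conv_nth)
  qed
  moreover have "e \<in> parcs G \<and> fst e \<in> set p \<and> snd e \<in> set p"
    if "e \<in> set (vwalk_arcs p) \<union> (set (vwalk_arcs p))\<inverse>" for e
    using that step by (auto simp: set_vwalk_arcs_conv_nth intro: arcs_symmetric)
  ultimately have "{e \<in> parcs G. fst e \<in> set p \<and> snd e \<in> set p} =
      set (vwalk_arcs p) \<union> (set (vwalk_arcs p))\<inverse>" by blast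
  moreover have "set (vwalk_arcs p) \<subseteq> parcs G" using step by (auto simp: set_vwalk_arcs_conv_nth)
  ultimately show ?L using R by (auto simp: chordless_path_def vpath_def vwalk_def)
qed

lemma vwalk_conv_nth:
  "vwalk p (with_proj G) \<longleftrightarrow>
     p \<noteq> [] \<and> set p \<subseteq> pverts G \<and> (\<forall>i. Suc i < length p \<longrightarrow> (p ! i, p ! Suc i) \<in> parcs G)"
  by (auto simp: vwalk_def set_vwalk_arcs_conv_nth)

text \<open>The detour between positions \<open>i\<close> and \<open>j\<close> is cut out. For
  \<open>j > Suc i\<close> the walk becomes shorter, which is how minimality excludes
  chords.\<close>

lemma vwalk_shortcut:
  assumes w: "vwalk p (with_proj G)" and ij: "i < j" "j < length p" and e: "(p ! i, p ! j) \<in> parcs G"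
  shows "vwalk (take (Suc i) p @ drop j p) (with_proj G)"
proof -
  have "((take (Suc i) p @ drop j p) ! k, (take (Suc i) p @ drop j p) ! Suc k) \<in> parcs G"
    if k: "Suc k < length (take (Suc i) p @ drop j p)" for k
  proof -
    consider "k < i" | "k = i" | "k > i" by linarith
    then show ?thesis
    proof cases
      case 1 then show ?thesis using w ij by (auto simp: vwalk_conv_nth nth_append)
    next
      case 2 then show ?thesis using e ij by (auto simp: nth_append)
    next
      case 3
      then obtain d where d: "k = Suc i + d" by (metis less_iff_Suc_add add_Suc)
      have "(p ! (j + d), p ! Suc (j + d)) \<in> parcs G"
        using w k ij d by (auto simp: vwalk_conv_nth)
      then show ?thesis using ij d by (auto simp: nth_append)
    qed
  qed
  moreover have "set (take (Suc i) p @ drop j p) \<subseteq> set p"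
    by (auto dest: in_set_takeD in_set_dropD)
  ultimately show ?thesis using w ij unfolding vwalk_conv_nth by auto
qed

text \<open>A shortest walk with the same ends, among those using only vertices of \<open>p\<close>,
  has neither a chord nor a repeated vertex.\<close>

lemma chordless_path_of_vwalk:
  assumes "vwalk p (with_proj G)"
  shows "\<exists>q. chordless_path G (hd p) q (last p) \<and> set q \<subseteq> set p"
proof -
  let ?W = "\<lambda>q. vwalk q (with_proj G) \<and> hd q = hd p \<and> last q = last p \<and> set q \<subseteq> set p"
  obtain q where q: "?W q" and min: "\<And>r. ?W r \<Longrightarrow> length q \<le> length r"
    using ex_has_least_nat[of ?W p length] assms by auto
  have ne: "q \<noteq> []" using q by (auto simp: vwalk_def)
  \<comment> \<open>Minimality against the shortcut: jumping from \<open>i\<close> to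
    \<open>j\<close> saves nothing, that is \<open>j \<le> Suc i\<close>.\<close>
  have cut: "length q \<le> Suc i + (length q - j)" if "i < j" "j < length q"
    "vwalk (take (Suc i) q @ drop j q) (with_proj G)" for i j
  proof -
    have "set (take (Suc i) q @ drop j q) \<subseteq> set p"
      using q by (auto dest: in_set_takeD in_set_dropD)
    then have "?W (take (Suc i) q @ drop j q)" using q that ne by auto
    from min[OF this] show ?thesis using that by simp
  qed
  have chord: "j = Suc i" if "i < j" "j < length q" "(q ! i, q ! j) \<in> parcs G" for i j
    using cut[OF that(1,2) vwalk_shortcut[OF _ that]] q that by auto
  have step: "(q ! i, q ! Suc i) \<in> parcs G" if "Suc i < length q" for i
    using q that by (auto simp: vwalk_conv_nth)
  \<comment> \<open>A repetition turns the arc leaving position \<open>j\<close> into a chord from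
    \<open>i\<close> to \<open>Suc j\<close>. If \<open>j\<close> is the last position, the walk
    could have stopped at \<open>i\<close>.\<close>
  have "q ! i \<noteq> q ! j" if ij: "i < j" "j < length q" for i j
  proof
    assume eq: "q ! i = q ! j"
    show False
    proof (cases "Suc j < length q")
      case True
      then have "(q ! i, q ! Suc j) \<in> parcs G" using step eq by simp
      from chord[OF _ True this] ij show False by simp
    next
      case False
      then have j: "Suc j = length q" using ij by simp
      have "last (take (Suc i) q) = last p"
      proof -
        have "j = length q - 1" using j by simp
        then have "last (take (Suc i) q) = last q"
          using eq ij ne by (simp add: take_Suc_conv_app_nth last_conv_nth)
        then show ?thesis using q by simp
      qed
      moreover have "vwalk (take (Suc i) q) (with_proj G)"
        using q ij by (auto simp: vwalk_conv_nth dest: in_set_takeD)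
      moreover have "hd (take (Suc i) q) = hd p" using q by simp
      moreover have "set (take (Suc i) q) \<subseteq> set p" using q by (auto dest: in_set_takeD)
      ultimately have "length q \<le> length (take (Suc i) q)" by (intro min) blast
      then show False using ij j by simp
    qed
  qed
  then have "distinct q" by (metis distinct_conv_nth nat_neq_iff)
  then have "chordless_path G (hd p) q (last p)"
    unfolding chordless_path_conv_nth using q ne chord step by (auto simp: vwalk_def)
  then show ?thesis using q by blast
qed

end

text \<open>One-sided: boundary vertices of \<open>H\<close> are given through cut edges that
  witness them. The other boundary is treated by passing to \<open>pverts G - H\<close>.\<close>

definition clique_boundary :: "'a pair_pre_digraph \<Rightarrow> 'a set \<Rightarrow> bool" where
  "clique_boundary G H \<longleftrightarrow> (\<forall>x\<in>H. \<forall>x'\<in>H. \<forall>y\<in>pverts G - H. \<forall>y'\<in>pverts G - H.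
     (x, y) \<in> parcs G \<longrightarrow> (x', y') \<in> parcs G \<longrightarrow> x = x' \<or> (x, x') \<in> parcs G)"

section \<open>Half-spaces as sets whose two boundaries are cliques\<close>

context pair_graph
begin

text \<open>A path with a vertex \<open>p ! k\<close> outside \<open>H\<close> leaves
  \<open>H\<close> at some \<open>i < k\<close> and is back at some \<open>j > k\<close>. The clique
  condition makes these two adjacent or equal, but their positions are at least two apart.\<close>

lemma convex_if_clique_boundary:
  assumes H: "H \<subseteq> pverts G" and cb: "clique_boundary G H"
  shows "convex G H"
  unfolding convex_def
proof (intro conjI ballI allI impI H)
  fix u v p assume uv: "u \<in> H" "v \<in> H" and "chordless_path G u p v"
  then have ne: "p \<noteq> []" and V: "set p \<subseteq> pverts G" and d: "distinct p"
    and hd: "hd p = u" and last: "last p = v"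
    and ch: "\<And>i j. i < j \<Longrightarrow> j < length p \<Longrightarrow> (p ! i, p ! j) \<in> parcs G \<longleftrightarrow> j = Suc i"
    unfolding chordless_path_conv_nth by blast+
  show "set p \<subseteq> H"
  proof (rule ccontr)
    assume "\<not> set p \<subseteq> H"
    then obtain k where k: "k < length p" "p ! k \<notin> H" by (metis in_set_conv_nth subsetI)
    have "\<exists>i<k. p ! i \<in> H \<and> p ! Suc i \<notin> H"
    proof (rule ccontr)
      assume "\<not> ?thesis"
      then have "p ! i \<in> H" if "i \<le> k" for i
        using that uv hd ne by (induction i) (auto simp: hd_conv_nth)
      then show False using k by blast
    qed
    then obtain i where i: "i < k" "p ! i \<in> H" "p ! Suc i \<notin> H" by blast
    have "\<exists>j>k. j < length p \<and> p ! j \<in> H \<and> p ! (j - 1) \<notin> H"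
    proof (rule ccontr)
      assume no: "\<not> ?thesis"
      have "k \<le> j \<Longrightarrow> j < length p \<Longrightarrow> p ! j \<notin> H" for j
      proof (induction j rule: dec_induct)
        case base then show ?case using k by simp
      next
        case (step j)
        then have "p ! (Suc j - 1) \<notin> H" "k < Suc j" by simp_all
        then show ?case using no step.prems by blast
      qed
      moreover have "k \<le> length p - 1" "length p - 1 < length p" using k(1) by simp_all
      ultimately show False using uv(2) last ne by (metis last_conv_nth)
    qed
    then obtain j where j: "k < j" "j < length p" "p ! j \<in> H" "p ! (j - 1) \<notin> H" by blast
    have e1: "(p ! i, p ! Suc i) \<in> parcs G" using ch i j by simp
    have "(p ! (j - 1), p ! j) \<in> parcs G" using ch[of "j - 1" j] j by simp
    then have e2: "(p ! j, p ! (j - 1)) \<in> parcs G" by (rule arcs_symmetric)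
    have "p ! Suc i \<in> pverts G - H" "p ! (j - 1) \<in> pverts G - H"
      using V i j by (auto simp: subset_iff)
    with cb i j e1 e2 have "p ! i = p ! j \<or> (p ! i, p ! j) \<in> parcs G"
      unfolding clique_boundary_def by blast
    then show False using d ch[of i j] i j by (auto simp: nth_eq_iff_index_eq)
  qed
qed

text \<open>Joining \<open>y\<close> and \<open>y'\<close> inside the complement and adding the two
  cut edges gives a walk from \<open>x\<close> to \<open>x'\<close>. A chordless path inside this
  walk has to stay in \<open>H\<close>, so it has no vertices besides its ends.\<close>

lemma clique_boundary_if_convex:
  assumes conn: "Digraph_Component.connected (with_proj G)"
    and H: "convex G H" and H': "convex G (pverts G - H)"
  shows "clique_boundary G H"
  unfolding clique_boundary_def
proof (intro ballI impI)
  fix x x' y y'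
  assume x: "x \<in> H" "x' \<in> H" and y: "y \<in> pverts G - H" "y' \<in> pverts G - H"
    and e: "(x, y) \<in> parcs G" "(x', y') \<in> parcs G"
  \<comment> \<open>Connectedness is defined through the symmetric closure, which changes nothing as
    the arcs are symmetric.\<close>
  have "reachable (with_proj G) y y'"
    using conn y reachable_mk_symmetric_eq[OF sym_arcs]
    by (auto simp: connected_def strongly_connected_def)
  then obtain w where w: "vwalk w (with_proj G)" "hd w = y" "last w = y'"
    using reachable_vwalk_conv by blast
  then obtain q where q: "chordless_path G y q y'"
    using chordless_path_of_vwalk by blast
  have qH: "set q \<subseteq> pverts G - H" using H' q y by (auto simp: convex_def)
  have vq: "vwalk q (with_proj G)" "hd q = y" "last q = y'" "q \<noteq> []"
    using q by (auto simp: chordless_path_def vpath_def vwalk_def)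
  have "vwalk (x # q @ [x']) (with_proj G)"
  proof -
    have qn: "q ! 0 = y" "q ! (length q - 1) = y'" using vq by (auto simp: hd_conv_nth last_conv_nth)
    have st: "\<And>i. Suc i < length q \<Longrightarrow> (q ! i, q ! Suc i) \<in> parcs G"
      using vq(1) by (auto simp: vwalk_conv_nth)
    have "((x # q @ [x']) ! i, (x # q @ [x']) ! Suc i) \<in> parcs G"
      if "Suc i < length (x # q @ [x'])" for i
    proof (cases i)
      case 0 then show ?thesis using e(1) qn vq by (simp add: nth_append)
    next
      case (Suc j)
      then have "Suc j < length q \<or> j = length q - 1 \<and> Suc j = length q" using that vq by auto
      then show ?thesis using Suc st qn arcs_symmetric[OF e(2)] by (auto simp: nth_append)
    qed
    moreover have "x \<in> pverts G" "x' \<in> pverts G" using e in_arcsD1 by auto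
    ultimately show ?thesis using qH unfolding vwalk_conv_nth by auto
  qed
  from chordless_path_of_vwalk[OF this]
  obtain r where r: "chordless_path G x r x'" and rs: "set r \<subseteq> set (x # q @ [x'])" by auto
  have "set r \<subseteq> H" using H r x by (auto simp: convex_def)
  then have r2: "set r \<subseteq> {x, x'}" using rs qH by auto
  from r have d: "distinct r" "r \<noteq> []" "hd r = x" "last r = x'"
    and ch: "\<And>i j. i < j \<Longrightarrow> j < length r \<Longrightarrow> (r ! i, r ! j) \<in> parcs G \<longleftrightarrow> j = Suc i"
    unfolding chordless_path_conv_nth by blast+
  have "length r \<le> 2"
  proof -
    have "length r = card (set r)" using d by (simp add: distinct_card)
    also have "\<dots> \<le> card {x, x'}" using r2 by (intro card_mono) auto
    also have "\<dots> \<le> 2" by (auto simp: card_insert_if)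
    finally show ?thesis .
  qed
  with d(2) consider "length r = 1" | "length r = 2"
    by (metis One_nat_def le_SucE le_zero_eq length_0_conv numeral_2_eq_2)
  then show "x = x' \<or> (x, x') \<in> parcs G"
  proof cases
    case 1 then show ?thesis using d by (auto simp: length_Suc_conv)
  next
    case 2
    then show ?thesis using ch[of 0 1] d by (auto simp: hd_conv_nth last_conv_nth)
  qed
qed

lemma half_space_iff_clique_boundary:
  assumes "Digraph_Component.connected (with_proj G)"
  shows "half_space G H \<longleftrightarrow>
    H \<subseteq> pverts G \<and> clique_boundary G H \<and> clique_boundary G (pverts G - H)"
proof
  assume "half_space G H"
  then have c: "convex G H" "convex G (pverts G - H)" by (auto simp: half_space_def)
  moreover from c(1) have "H \<subseteq> pverts G" by (simp add: convex_def)
  moreover from this have "pverts G - (pverts G - H) = H" by blast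
  ultimately show "H \<subseteq> pverts G \<and> clique_boundary G H \<and> clique_boundary G (pverts G - H)"
    using clique_boundary_if_convex[OF assms] by simp
next
  assume "H \<subseteq> pverts G \<and> clique_boundary G H \<and> clique_boundary G (pverts G - H)"
  then show "half_space G H" by (simp add: half_space_def convex_if_clique_boundary)
qed

end


section \<open>2-SAT by variable elimination\<close>

text \<open>A literal below \<open>n\<close> is a variable, and \<open>v + n\<close> is the negation of the variable \<open>v\<close>.\<close>

definition lit_true :: "nat \<Rightarrow> (nat \<Rightarrow> bool) \<Rightarrow> nat \<Rightarrow> bool" where
  "lit_true n h l \<longleftrightarrow> (if l < n then h l else \<not> h (l - n))"

text \<open>\<open>K l m\<close> stands for the clause that \<open>l\<close> and \<open>m\<close>
  are not both true, and \<open>l mod n\<close> is the variable of the literal \<open>l\<close>.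
  Restricting to variables below \<open>k\<close> makes \<open>k\<close> available for
  induction.\<close>

definition avoids :: "nat \<Rightarrow> nat \<Rightarrow> (nat \<Rightarrow> nat \<Rightarrow> bool) \<Rightarrow> (nat \<Rightarrow> bool) \<Rightarrow> bool" where
  "avoids n k K h \<longleftrightarrow> (\<forall>l m. l < 2 * n \<longrightarrow> m < 2 * n \<longrightarrow> l mod n < k \<longrightarrow> m mod n < k \<longrightarrow>
     K l m \<longrightarrow> lit_true n h l \<longrightarrow> lit_true n h m \<longrightarrow> False)"

text \<open>
  \<open>K l l\<close> is a unit clause.  It has to be resolved as if it conflicted with every literal, as
  otherwise eliminating a variable with a unit clause would lose consequences.
\<close>

definition weakened :: "(nat \<Rightarrow> nat \<Rightarrow> bool) \<Rightarrow> nat \<Rightarrow> nat \<Rightarrow> bool" where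
  "weakened K l m \<longleftrightarrow> K l m \<or> K l l \<or> K m m"

text \<open>Resolution on the variable \<open>k\<close>. Old clauses stay in the matrix; those
  mentioning \<open>k\<close> are ignored by \<open>avoids n k\<close>.\<close>

definition elim_var :: "nat \<Rightarrow> nat \<Rightarrow> (nat \<Rightarrow> nat \<Rightarrow> bool) \<Rightarrow> nat \<Rightarrow> nat \<Rightarrow> bool" where
  "elim_var n k K l m \<longleftrightarrow> K l m \<or>
     weakened K l k \<and> weakened K (k + n) m \<or> weakened K l (k + n) \<and> weakened K k m"

text \<open>\<open>foldr\<close> treats the last list element first, so on \<open>[0..<n]\<close>
  the largest variable is eliminated first.\<close>

definition elim_vars :: "nat \<Rightarrow> nat list \<Rightarrow> (nat \<Rightarrow> nat \<Rightarrow> bool) \<Rightarrow> nat \<Rightarrow> nat \<Rightarrow> bool" where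
  "elim_vars n ks K = foldr (elim_var n) ks K"

lemma symp_elim_var: "symp K \<Longrightarrow> symp (elim_var n k K)"
  unfolding elim_var_def weakened_def symp_def by blast

lemma elim_var_mono: "K l m \<Longrightarrow> elim_var n k K l m"
  by (simp add: elim_var_def)

lemma elim_vars_mono: "K l m \<Longrightarrow> elim_vars n ks K l m"
  by (induction ks) (auto simp: elim_vars_def elim_var_mono)

text \<open>Soundness of resolution: one of \<open>k\<close> and \<open>k + n\<close> is true under
  \<open>h\<close>, and the clause containing the true one already makes \<open>l\<close> or
  \<open>m\<close> false.\<close>

lemma avoids_elim_var:
  assumes h: "avoids n n K h" and k: "k < n"
  shows "avoids n n (elim_var n k K) h"
proof -
  have n: "n > 0" using k by simp
  have K: "\<not> (lit_true n h l \<and> lit_true n h m)" if "l < 2 * n" "m < 2 * n" "K l m" for l m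
    using h that n by (auto simp: avoids_def)
  then have W: "\<not> (lit_true n h l \<and> lit_true n h m)" if "l < 2 * n" "m < 2 * n" "weakened K l m" for l m
    using that unfolding weakened_def by blast
  have hk: "lit_true n h k \<or> lit_true n h (k + n)" using k by (auto simp: lit_true_def)
  have kn: "k < 2 * n" "k + n < 2 * n" using k by simp_all
  show ?thesis
    unfolding avoids_def
  proof (intro allI impI)
    fix l m assume l: "l < 2 * n" "lit_true n h l" and m: "m < 2 * n" "lit_true n h m"
      and "elim_var n k K l m"
    then consider "K l m" | "weakened K l k" "weakened K (k + n) m" | "weakened K l (k + n)" "weakened K k m"
      unfolding elim_var_def by blast
    then show False
    proof cases
      case 1 then show ?thesis using K l m by blast
    next
      case 2 then show ?thesis using W[OF l(1) kn(1)] W[OF kn(2) m(1)] hk l m by blast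
    next
      case 3 then show ?thesis using W[OF l(1) kn(2)] W[OF kn(1) m(1)] hk l m by blast
    qed
  qed
qed

lemma avoids_elim_vars:
  assumes h: "avoids n n K h" and "set ks \<subseteq> {..<n}"
  shows "avoids n n (elim_vars n ks K) h"
  using assms(2) by (induction ks) (auto simp: elim_vars_def h avoids_elim_var)

text \<open>Completeness of resolution: the variable \<open>k\<close> is made true unless a true
  literal or \<open>k\<close> itself forbids it. If its negation were forbidden too,
  \<open>h\<close> would already violate a resolvent; two opposite unit clauses on \<open>k\<close>
  are excluded by \<open>no\<close>.\<close>

lemma avoids_extend:
  assumes sym: "symp K" and k: "k < n" and h: "avoids n k (elim_var n k K) h"
    and no: "\<not> (K k k \<and> K (k + n) (k + n))"
  shows "\<exists>h'. avoids n (Suc k) K h'"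
proof -
  \<comment> \<open>\<open>T\<close> holds for the true literals of the variables already decided by
    \<open>h\<close>.\<close>
  define T where "T l \<longleftrightarrow> l < 2 * n \<and> l mod n < k \<and> lit_true n h l" for l
  have T: "\<not> elim_var n k K l m" if "T l" "T m" for l m
    using that h by (auto simp: T_def avoids_def)
  define f where "f \<longleftrightarrow> \<not> (\<exists>l. (T l \<or> l = k) \<and> K l k)"
  define h' where "h' = h(k := f)"
  have split: "l mod n < k \<or> l = k \<or> l = k + n" if "l < 2 * n" "l mod n < Suc k" for l
    using that k by (cases "l < n") (auto simp: le_mod_geq)
  have tr: "T l \<or> l = k \<and> f \<or> l = k + n \<and> \<not> f"
    if l: "l < 2 * n" "l mod n < Suc k" "lit_true n h' l" for l
  proof -
    have "lit_true n h l" if "l mod n < k"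
      using l that k by (auto simp: lit_true_def h'_def le_mod_geq split: if_splits)
    then show ?thesis using split[OF l(1,2)] l k
      by (auto simp: T_def lit_true_def h'_def split: if_splits)
  qed
  have TT: False if "T l" "T m" "K l m" for l m
    using T[OF that(1,2)] that(3) by (simp add: elim_var_def)
  have pos: False if "T l" "f" "K l k" for l using that f_def by blast
  have pos2: False if "f" "K k k" using that f_def by blast
  have neg: False if "\<not> f" "T m \<or> m = k + n" "K (k + n) m" for m
  proof -
    from \<open>\<not> f\<close> obtain l where l: "T l \<or> l = k" "K l k" unfolding f_def by blast
    have kn: "K (k + n) (k + n)" if "m = k + n" using that \<open>K (k + n) m\<close> by simp
    show False
      using that(2)
    proof
      assume m: "T m"
      show False
        using l(1)
      proof
        assume "T l" then show False using T[OF _ m] l(2) that(3) by (auto simp: elim_var_def weakened_def)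
      next
        \<comment> \<open>The unit clause \<open>K k k\<close> resolves with the clause on
          \<open>k + n\<close> and \<open>m\<close> to a unit clause on \<open>m\<close>; this is
          what weakening provides.\<close>
        assume "l = k"
        then show False using T[OF m m] l(2) that(3) by (auto simp: elim_var_def weakened_def)
      qed
    next
      assume m: "m = k + n"
      show False
        using l(1)
      proof
        assume "T l" then show False using T[of l l] l(2) kn[OF m] by (auto simp: elim_var_def weakened_def)
      next
        assume "l = k" then show False using no l(2) kn[OF m] by simp
      qed
    qed
  qed
  have "avoids n (Suc k) K h'"
    unfolding avoids_def
  proof (intro allI impI)
    fix l m assume lm: "l < 2 * n" "m < 2 * n" "l mod n < Suc k" "m mod n < Suc k"
      and K: "K l m" and t: "lit_true n h' l" "lit_true n h' m"
    have K': "K m l" using sympD[OF sym K] .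
    from tr[OF lm(1,3) t(1)] tr[OF lm(2,4) t(2)] show False
    proof (elim disjE conjE)
      assume "T l" "T m" then show False using TT K by blast
    next
      assume "T l" "m = k" "f" then show False using pos K by blast
    next
      assume "T l" "m = k + n" "\<not> f" then show False using neg K' by blast
    next
      assume "l = k" "f" "T m" then show False using pos K' by blast
    next
      assume "l = k" "f" "m = k" then show False using pos2 K by blast
    next
      assume "l = k + n" "\<not> f" "T m" then show False using neg K by blast
    next
      assume "l = k + n" "\<not> f" "m = k + n" then show False using neg K by blast
    qed simp_all
  qed
  then show ?thesis by blast
qed

text \<open>Opposite unit clauses refute the instance since elimination is sound. Without them an
  assignment is built up from variable 0, undoing the eliminations in reverse order.\<close>

lemma avoids_iff_elim_vars:
  assumes sym: "symp K"
  shows "(\<exists>h. avoids n n K h) \<longleftrightarrow>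
    \<not> (\<exists>v<n. elim_vars n [0..<n] K v v \<and> elim_vars n [0..<n] K (v + n) (v + n))"
proof
  assume "\<exists>h. avoids n n K h"
  then obtain h where "avoids n n K h" by blast
  then have h: "avoids n n (elim_vars n [0..<n] K) h" by (rule avoids_elim_vars) auto
  show "\<not> (\<exists>v<n. elim_vars n [0..<n] K v v \<and> elim_vars n [0..<n] K (v + n) (v + n))"
  proof
    assume "\<exists>v<n. elim_vars n [0..<n] K v v \<and> elim_vars n [0..<n] K (v + n) (v + n)"
    then obtain v where v: "v < n" "elim_vars n [0..<n] K v v" "elim_vars n [0..<n] K (v + n) (v + n)"
      by blast
    have "\<not> lit_true n h v" using h[unfolded avoids_def, rule_format, of v v] v by auto
    moreover have "\<not> lit_true n h (v + n)"
      using h[unfolded avoids_def, rule_format, of "v + n" "v + n"] v by auto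
    ultimately show False using v(1) by (auto simp: lit_true_def)
  qed
next
  assume no: "\<not> (\<exists>v<n. elim_vars n [0..<n] K v v \<and> elim_vars n [0..<n] K (v + n) (v + n))"
  \<comment> \<open>\<open>K\<close> is generalised because eliminating the variable
    \<open>k\<close> changes the matrix.\<close>
  have "k \<le> n \<Longrightarrow> symp K \<Longrightarrow>
    \<not> (\<exists>v<n. elim_vars n [0..<k] K v v \<and> elim_vars n [0..<k] K (v + n) (v + n)) \<Longrightarrow>
    \<exists>h. avoids n k K h" for k
  proof (induction k arbitrary: K)
    case 0 then show ?case by (auto simp: avoids_def)
  next
    case (Suc k)
    have e: "elim_vars n [0..<Suc k] K = elim_vars n [0..<k] (elim_var n k K)"
      by (simp add: elim_vars_def)
    have k: "k \<le> n" "k < n" using Suc.prems(1) by simp_all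
    have "\<exists>h. avoids n k (elim_var n k K) h"
      using Suc.IH[OF k(1) symp_elim_var[OF Suc.prems(2)]] Suc.prems(3) unfolding e by blast
    \<comment> \<open>Elimination deletes no clause, so opposite unit clauses on \<open>k\<close>
      would survive to the end.\<close>
    moreover have "\<not> (K k k \<and> K (k + n) (k + n))"
      using Suc.prems(3) k(2) elim_vars_mono[of K _ _ n "[0..<Suc k]"] by blast
    moreover note k(2)
    ultimately show ?case using avoids_extend[OF Suc.prems(2)] by blast
  qed
  from this[OF le_refl sym no] show "\<exists>h. avoids n n K h" .
qed


section \<open>Separation as a 2-SAT instance\<close>

text \<open>
  If \<open>(a, b)\<close> is a cut edge and \<open>x\<close> is a neighbour of \<open>a\<close> outside the closed neighbourhood of
  \<open>b\<close>, then \<open>x\<close> cannot be on the side of \<open>b\<close>, as \<open>b\<close> and \<open>x\<close> would be nonadjacent boundary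
  vertices of that side.
\<close>

definition forced :: "'a rel \<Rightarrow> 'a set \<Rightarrow> 'a set \<Rightarrow> 'a \<Rightarrow> bool" where
  "forced E A B x \<longleftrightarrow> x \<in> A \<or>
     (\<exists>a\<in>A. \<exists>b\<in>B. (a, b) \<in> E \<and> (a, x) \<in> E \<and> x \<noteq> b \<and> (b, x) \<notin> E)"

text \<open>A violation has \<open>x\<close>, \<open>x'\<close> in the half-space and
  \<open>y\<close>, \<open>y'\<close> outside, each forced there or put there by one of the two
  literals. The alternative \<open>x = y\<close> is a vertex on both sides; it yields the unit
  clauses for forced vertices.\<close>

definition conflict :: "nat \<Rightarrow> nat rel \<Rightarrow> nat set \<Rightarrow> nat set \<Rightarrow> nat \<Rightarrow> nat \<Rightarrow> bool" where
  "conflict n E A B l m \<longleftrightarrow> (\<exists>x<n. \<exists>x'<n. \<exists>y<n. \<exists>y'<n.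
     (forced E A B x \<or> l = x \<or> m = x) \<and> (forced E A B x' \<or> l = x' \<or> m = x') \<and>
     (forced E B A y \<or> l = y + n \<or> m = y + n) \<and> (forced E B A y' \<or> l = y' + n \<or> m = y' + n) \<and>
     (x = y \<or> (x, y) \<in> E \<and> (x', y') \<in> E \<and>
       (x \<noteq> x' \<and> (x, x') \<notin> E \<or> y \<noteq> y' \<and> (y, y') \<notin> E)))"

lemma symp_conflict: "symp (conflict n E A B)"
proof (rule sympI)
  fix l m assume "conflict n E A B l m"
  then show "conflict n E A B m l" unfolding conflict_def by (elim exE conjE) (intro exI conjI; blast)
qed

text \<open>
  A violation of the clique condition involves up to four undecided vertices.  Trading one of its
  cut edges for an edge to \<open>a\<close> or \<open>b\<close> leaves at most two, \<open>u\<close> and \<open>v\<close>.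
\<close>

lemma boundary_from_pairs:
  assumes sym: "\<And>x y. E x y \<Longrightarrow> E y x"
    and ab: "E a b" "P a" "\<not> P b" "F a" "F' b"
    and F: "\<And>x. E a x \<Longrightarrow> x \<noteq> b \<Longrightarrow> \<not> E b x \<Longrightarrow> F x"
    and pair: "\<And>u v x x' y y'. P x \<Longrightarrow> P x' \<Longrightarrow> \<not> P y \<Longrightarrow> \<not> P y' \<Longrightarrow> E x y \<Longrightarrow> E x' y' \<Longrightarrow>
       {u, v} \<subseteq> {x, x', y, y'} \<Longrightarrow>
       F x \<or> x = u \<or> x = v \<Longrightarrow> F x' \<or> x' = u \<or> x' = v \<Longrightarrow>
       F' y \<or> y = u \<or> y = v \<Longrightarrow> F' y' \<or> y' = u \<or> y' = v \<Longrightarrow> x = x' \<or> E x x'"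
    and x: "P x" "P x'" "\<not> P y" "\<not> P y'" "E x y" "E x' y'"
  shows "x = x' \<or> E x x'"
proof -
  \<comment> \<open>Against the cut edge from \<open>a\<close> to \<open>b\<close>, whose ends are
    settled, only \<open>z\<close> and \<open>w\<close> are undecided.\<close>
  have near: "z = a \<or> E a z" if "P z" "\<not> P w" "E z w" for z w
    using pair[OF that(1) ab(2) that(2) ab(3) that(3) ab(1), of z w] ab sym by blast
  \<comment> \<open>So a boundary vertex is adjacent to \<open>b\<close>, or it is \<open>a\<close>
    or a neighbour of \<open>a\<close> alone, whose side is known.\<close>
  have cases: "E z b \<or> F z" if "P z" "\<not> P w" "E z w" for z w
    using near[OF that] F[of z] ab sym that by blast
  show ?thesis
    using cases[OF x(1,3,5)] cases[OF x(2,4,6)]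
  proof (elim disjE)
    \<comment> \<open>Both cut edges are redirected to \<open>b\<close>, leaving only
      \<open>x\<close> and \<open>x'\<close> undecided.\<close>
    assume "E x b" "E x' b"
    then show ?thesis using pair[OF x(1,2) ab(3,3), of x x'] ab by blast
  next
    assume "E x b" "F x'"
    then show ?thesis using pair[OF x(1,2) ab(3) x(4) _ x(6), of x y'] ab by blast
  next
    assume "F x" "E x' b"
    then show ?thesis using pair[OF x(1,2) x(3) ab(3) x(5), of x' y] ab by blast
  next
    assume "F x" "F x'"
    then show ?thesis using pair[OF x, of y y'] ab by blast
  qed
qed

context pair_graph
begin

lemma forced_in_half_space:
  assumes "A \<subseteq> H" "B \<inter> H = {}" and cb: "clique_boundary G (pverts G - H)"
    and x: "forced (parcs G) A B x" and H: "H \<subseteq> pverts G"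
  shows "x \<in> H"
proof (rule ccontr)
  assume nx: "x \<notin> H"
  with x assms obtain a b where ab: "a \<in> A" "b \<in> B" "(a, b) \<in> parcs G" "(a, x) \<in> parcs G"
    "x \<noteq> b" "(b, x) \<notin> parcs G" unfolding forced_def by blast
  have "b \<in> pverts G - H" "x \<in> pverts G - H" "a \<in> pverts G - (pverts G - H)"
    using ab nx assms in_arcsD2 in_arcsD1 by blast+
  then show False using cb ab arcs_symmetric unfolding clique_boundary_def by blast
qed

end

text \<open>Membership in \<open>H\<close> and truth under the assignment correspond to each other.
  For the converse direction, \<open>boundary_from_pairs\<close> lifts the absence of pairwise
  conflicts to the clique condition, once for each side.\<close>

lemma separated_iff_avoids:
  fixes G :: "nat pair_pre_digraph"
  assumes G: "pair_graph G" and conn: "Digraph_Component.connected (with_proj G)"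
    and V: "pverts G = {..<n}" and AB: "A \<subseteq> pverts G" "B \<subseteq> pverts G" and link: "linked G A B"
  shows "separated_by_half_spaces G A B \<longleftrightarrow> (\<exists>h. avoids n n (conflict n (parcs G) A B) h)"
proof
  interpret pair_graph G by fact
  assume "separated_by_half_spaces G A B"
  then obtain H where H: "H \<subseteq> pverts G" and cb: "clique_boundary G H"
    and cb': "clique_boundary G (pverts G - H)" and A: "A \<subseteq> H" and B: "B \<subseteq> pverts G - H"
    unfolding separated_by_half_spaces_def half_space_iff_clique_boundary[OF conn] by blast
  have HH: "pverts G - (pverts G - H) = H" using H by blast
  have F1: "x \<in> H" if "forced (parcs G) A B x" for x
    using forced_in_half_space[OF A _ cb' that H] B by blast
  have F0: "x \<in> pverts G - H" if "forced (parcs G) B A x" for x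
    using forced_in_half_space[OF B, of A x] A cb that unfolding HH by blast
  have "avoids n n (conflict n (parcs G) A B) (\<lambda>v. v \<in> H)"
    unfolding avoids_def
  proof (intro allI impI)
    fix l m
    assume tr: "lit_true n (\<lambda>v. v \<in> H) l" "lit_true n (\<lambda>v. v \<in> H) m"
      and "conflict n (parcs G) A B l m"
    then obtain x x' y y' where b: "x < n" "x' < n" "y < n" "y' < n" and
      c: "forced (parcs G) A B x \<or> l = x \<or> m = x" "forced (parcs G) A B x' \<or> l = x' \<or> m = x'"
      "forced (parcs G) B A y \<or> l = y + n \<or> m = y + n"
      "forced (parcs G) B A y' \<or> l = y' + n \<or> m = y' + n"
      and d: "x = y \<or> (x, y) \<in> parcs G \<and> (x', y') \<in> parcs G \<and>
       (x \<noteq> x' \<and> (x, x') \<notin> parcs G \<or> y \<noteq> y' \<and> (y, y') \<notin> parcs G)"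
      unfolding conflict_def by blast
    have i: "z \<in> H" if "z < n" "forced (parcs G) A B z \<or> l = z \<or> m = z" for z
      using that F1 tr by (auto simp: lit_true_def)
    have o: "z \<in> pverts G - H" if "z < n" "forced (parcs G) B A z \<or> l = z + n \<or> m = z + n" for z
      using that F0 tr V by (auto simp: lit_true_def)
    have "x \<in> H" "x' \<in> H" "y \<in> pverts G - H" "y' \<in> pverts G - H"
      using i o b c by blast+
    then show False
      using d cb cb' arcs_symmetric unfolding clique_boundary_def HH by blast
  qed
  then show "\<exists>h. avoids n n (conflict n (parcs G) A B) h"
    by (rule exI[where P = "avoids n n (conflict n (parcs G) A B)"])
next
  interpret pair_graph G by fact
  assume "\<exists>h. avoids n n (conflict n (parcs G) A B) h"
  then obtain h where h: "avoids n n (conflict n (parcs G) A B) h" by (elim exE)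
  \<comment> \<open>\<open>L u\<close> is the literal of \<open>u\<close> that is true under
    \<open>h\<close>, so no two of these conflict.\<close>
  define L where "L u = (if h u then u else u + n)" for u
  have ok: "\<not> conflict n (parcs G) A B (L u) (L v)" if "u < n" "v < n" for u v
    using h[unfolded avoids_def, rule_format, of "L u" "L v"] that
    by (auto simp: L_def lit_true_def)
  have Lpos: "L u = x \<longleftrightarrow> h u \<and> u = x" if "x < n" for u x using that by (auto simp: L_def)
  have Lneg: "L u = x + n \<longleftrightarrow> \<not> h u \<and> u = x" if "u < n" for u x using that by (auto simp: L_def)
  \<comment> \<open>By the alternative \<open>x = y\<close> in \<open>conflict\<close>, a vertex
    assigned against its forced side conflicts with itself.\<close>
  have F1: "h x" if "forced (parcs G) A B x" "x < n" for x
    using ok[OF that(2,2)] that Lneg[of x x] unfolding conflict_def by blast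
  have F0: "\<not> h x" if "forced (parcs G) B A x" "x < n" for x
    using ok[OF that(2,2)] that Lpos[of x x] unfolding conflict_def by blast
  obtain a b where ab: "a \<in> A" "b \<in> B" "(a, b) \<in> parcs G" using link unfolding linked_def by blast
  have Vab: "a < n" "b < n" using ab AB V by auto
  have Fab: "forced (parcs G) A B a" "forced (parcs G) B A b" using ab by (auto simp: forced_def)
  have En: "x < n" "y < n" if "(x, y) \<in> parcs G" for x y
    using in_arcsD1[OF that] in_arcsD2[OF that] V by auto
  \<comment> \<open>A violation with no undecided vertices besides \<open>u\<close> and
    \<open>v\<close> is a conflict between \<open>L u\<close> and \<open>L v\<close>.\<close>
  have pair: "(x = x' \<or> (x, x') \<in> parcs G) \<and> (y = y' \<or> (y, y') \<in> parcs G)"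
    if hx: "h x" "h x'" "\<not> h y" "\<not> h y'" and e: "(x, y) \<in> parcs G" "(x', y') \<in> parcs G"
      and uv: "{u, v} \<subseteq> {x, x', y, y'}"
      and f: "forced (parcs G) A B x \<or> x = u \<or> x = v" "forced (parcs G) A B x' \<or> x' = u \<or> x' = v"
       "forced (parcs G) B A y \<or> y = u \<or> y = v" "forced (parcs G) B A y' \<or> y' = u \<or> y' = v"
    for u v x x' y y'
  proof -
    have n: "x < n" "x' < n" "y < n" "y' < n" using En e by blast+
    have uvn: "u < n" "v < n" using uv n by auto
    have "forced (parcs G) A B z \<or> L u = z \<or> L v = z" if "z < n" "h z"
      "forced (parcs G) A B z \<or> z = u \<or> z = v" for z
      using that Lpos by blast
    note p = this[OF n(1) hx(1) f(1)] this[OF n(2) hx(2) f(2)]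
    have "forced (parcs G) B A z \<or> L u = z + n \<or> L v = z + n" if "z < n" "\<not> h z"
      "forced (parcs G) B A z \<or> z = u \<or> z = v" for z
      using that Lneg uvn by blast
    note q = this[OF n(3) hx(3) f(3)] this[OF n(4) hx(4) f(4)]
    show ?thesis
      using ok[OF uvn] n p q e unfolding conflict_def by blast
  qed
  define H where "H = {v. v < n \<and> h v}"
  have "clique_boundary G H"
    unfolding clique_boundary_def
  proof (intro ballI impI)
    fix x x' y y' assume *: "x \<in> H" "x' \<in> H" "y \<in> pverts G - H" "y' \<in> pverts G - H"
      "(x, y) \<in> parcs G" "(x', y') \<in> parcs G"
    show "x = x' \<or> (x, x') \<in> parcs G"
    proof (rule boundary_from_pairs[where E = "\<lambda>x y. (x, y) \<in> parcs G" and P = h and a = a and b = b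
          and F = "forced (parcs G) A B" and F' = "forced (parcs G) B A"])
      show "forced (parcs G) A B x" if "(a, x) \<in> parcs G" "x \<noteq> b" "(b, x) \<notin> parcs G" for x
        using that ab unfolding forced_def by blast
      show "h a" "\<not> h b" using F1 F0 Fab Vab by blast+
      show "h x" "h x'" "\<not> h y" "\<not> h y'" using * V by (auto simp: H_def)
      show "x = x' \<or> (x, x') \<in> parcs G"
        if "h x" "h x'" "\<not> h y" "\<not> h y'" "(x, y) \<in> parcs G" "(x', y') \<in> parcs G"
          "{u, v} \<subseteq> {x, x', y, y'}"
          "forced (parcs G) A B x \<or> x = u \<or> x = v" "forced (parcs G) A B x' \<or> x' = u \<or> x' = v"
          "forced (parcs G) B A y \<or> y = u \<or> y = v" "forced (parcs G) B A y' \<or> y' = u \<or> y' = v"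
        for u v x x' y y'
        using pair[OF that] by (rule conjunct1)
    qed (fact arcs_symmetric ab Fab *)+
  qed
  \<comment> \<open>For the other side, \<open>a\<close> and \<open>b\<close>, the two forced
    predicates and the truth values exchange their roles.\<close>
  moreover have "clique_boundary G (pverts G - H)"
    unfolding clique_boundary_def
  proof (intro ballI impI)
    fix x x' y y' assume *: "x \<in> pverts G - H" "x' \<in> pverts G - H"
      "y \<in> pverts G - (pverts G - H)" "y' \<in> pverts G - (pverts G - H)"
      "(x, y) \<in> parcs G" "(x', y') \<in> parcs G"
    show "x = x' \<or> (x, x') \<in> parcs G"
    proof (rule boundary_from_pairs[where E = "\<lambda>x y. (x, y) \<in> parcs G" and P = "\<lambda>x. \<not> h x"
          and a = b and b = a and F = "forced (parcs G) B A" and F' = "forced (parcs G) A B"])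
      show "forced (parcs G) B A x" if "(b, x) \<in> parcs G" "x \<noteq> a" "(a, x) \<notin> parcs G" for x
        using that ab arcs_symmetric unfolding forced_def by blast
      show "x = x' \<or> (x, x') \<in> parcs G"
        if "\<not> h x" "\<not> h x'" "\<not> \<not> h y" "\<not> \<not> h y'" "(x, y) \<in> parcs G" "(x', y') \<in> parcs G"
          "{u, v} \<subseteq> {x, x', y, y'}"
          "forced (parcs G) B A x \<or> x = u \<or> x = v" "forced (parcs G) B A x' \<or> x' = u \<or> x' = v"
          "forced (parcs G) A B y \<or> y = u \<or> y = v" "forced (parcs G) A B y' \<or> y' = u \<or> y' = v"
        for u v x x' y y'
      proof -
        have "{u, v} \<subseteq> {y, y', x, x'}" using that(7) by blast
        from pair[OF _ _ that(1,2) that(5,6)[THEN arcs_symmetric] this that(10,11,8,9)] that(3,4)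
        show ?thesis by blast
      qed
      show "\<not> h b" "\<not> \<not> h a" using F1 F0 Fab Vab by blast+
      show "\<not> h x" "\<not> h x'" "\<not> \<not> h y" "\<not> \<not> h y'" using * V by (auto simp: H_def)
    qed (fact arcs_symmetric ab(3)[THEN arcs_symmetric] Fab *)+
  qed
  moreover have "H \<subseteq> pverts G" using V by (auto simp: H_def)
  moreover have "A \<subseteq> H"
    using F1 AB V by (auto simp: H_def forced_def)
  moreover have "B \<subseteq> pverts G - H"
    using F0 AB V by (auto simp: H_def forced_def)
  ultimately show "separated_by_half_spaces G A B"
    unfolding separated_by_half_spaces_def half_space_iff_clique_boundary[OF conn] by blast
qed


section \<open>Programs for bounded first-order formulas\<close>

text \<open>The time is bounded in cell 0 of array 0 at the start, which holds the number of
  vertices. The final memory is a function of the initial one, so effects compose as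
  functions.\<close>

definition runs :: "(state \<Rightarrow> bool) \<Rightarrow> com \<Rightarrow> (state \<Rightarrow> state) \<Rightarrow> bool" where
  "runs P c f \<longleftrightarrow> (\<exists>p :: nat poly. \<forall>s. P s \<longrightarrow> (\<exists>t. exec c s t (f s) \<and> t \<le> poly p (s 0 0)))"

definition setv :: "nat \<Rightarrow> nat \<Rightarrow> state \<Rightarrow> state" where
  "setv v x s = s(v := (s v)(0 := x))"

abbreviation V :: "nat \<Rightarrow> exp" where "V v \<equiv> Cell v (Const 0)"

lemma setv_apply: "setv v x s w = (if w = v then (s v)(0 := x) else s w)"
  by (simp add: setv_def)

lemma setv_setv [simp]: "setv v x (setv v y s) = setv v x s"
  by (simp add: setv_def)

lemma setv_swap: "v \<noteq> w \<Longrightarrow> setv v x (setv w y s) = setv w y (setv v x s)"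
  by (auto simp: setv_def fun_eq_iff)

lemma setv_same: "s v 0 = x \<Longrightarrow> setv v x s = s"
  by (auto simp: setv_def)

section \<open>Effects and running times of composed programs\<close>

lemma runs_cong:
  assumes "runs P c f" "\<And>s. Q s \<Longrightarrow> P s" "\<And>s. Q s \<Longrightarrow> f s = g s"
  shows "runs Q c g"
  using assms unfolding runs_def by metis

lemma runs_Skip: "runs P Skip (\<lambda>s. s)"
  unfolding runs_def by (intro exI[of _ "[:1:]"]) (auto intro: exec.Skip)

lemma runs_Assign: "runs P (Assign a i e) (\<lambda>s. s(a := (s a)(val i s := val e s)))"
  unfolding runs_def
proof (intro exI[of _ "[:1 + cost i + cost e:]"] allI impI exI conjI)
  show "exec (Assign a i e) s (1 + cost i + cost e) (s(a := (s a)(val i s := val e s)))" for s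
    by (rule exec.Assign)
qed simp

lemma runs_setv: "runs P (Assign v (Const 0) e) (\<lambda>s. setv v (val e s) s)"
  using runs_Assign[of P v "Const 0" e] by (simp add: setv_def)

text \<open>The bound for \<open>d\<close> refers to cell 0 of array 0 at the start of
  \<open>d\<close>, hence \<open>f\<close> has to preserve that cell.\<close>

lemma runs_Seq:
  assumes c: "runs P c f" and d: "runs Q d g"
    and "\<And>s. P s \<Longrightarrow> Q (f s)" "\<And>s. P s \<Longrightarrow> f s 0 0 = s 0 0"
  shows "runs P (Seq c d) (\<lambda>s. g (f s))"
proof -
  obtain p where p: "\<And>s. P s \<Longrightarrow> \<exists>t. exec c s t (f s) \<and> t \<le> poly p (s 0 0)"
    using c unfolding runs_def by blast
  obtain q where q: "\<And>s. Q s \<Longrightarrow> \<exists>t. exec d s t (g s) \<and> t \<le> poly q (s 0 0)"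
    using d unfolding runs_def by blast
  have "\<exists>t. exec (Seq c d) s t (g (f s)) \<and> t \<le> poly (p + q) (s 0 0)" if s: "P s" for s
  proof -
    obtain t u where "exec c s t (f s)" "t \<le> poly p (s 0 0)"
      "exec d (f s) u (g (f s))" "u \<le> poly q (s 0 0)"
      using p[OF s] q[OF assms(3)[OF s]] assms(4)[OF s] by auto
    then show ?thesis by (intro exI[of _ "t + u"]) (auto intro: exec.Seq add_mono)
  qed
  then show ?thesis unfolding runs_def by blast
qed

lemma runs_If:
  assumes c: "runs (\<lambda>s. P s \<and> val b s \<noteq> 0) c f" and d: "runs (\<lambda>s. P s \<and> val b s = 0) d g"
  shows "runs P (If b c d) (\<lambda>s. if val b s \<noteq> 0 then f s else g s)"
proof -
  obtain p where p: "\<And>s. P s \<Longrightarrow> val b s \<noteq> 0 \<Longrightarrow> \<exists>t. exec c s t (f s) \<and> t \<le> poly p (s 0 0)"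
    using c unfolding runs_def by blast
  obtain q where q: "\<And>s. P s \<Longrightarrow> val b s = 0 \<Longrightarrow> \<exists>t. exec d s t (g s) \<and> t \<le> poly q (s 0 0)"
    using d unfolding runs_def by blast
  have "\<exists>t. exec (If b c d) s t (if val b s \<noteq> 0 then f s else g s) \<and>
      t \<le> poly (p + q + [:1 + cost b:]) (s 0 0)" if s: "P s" for s
  proof (cases "val b s = 0")
    case True
    obtain t where "exec d s t (g s)" "t \<le> poly q (s 0 0)" using q[OF s True] by blast
    then show ?thesis using True
      by (intro exI[of _ "1 + cost b + t"]) (auto intro: exec.IfFalse simp del: One_nat_def)
  next
    case False
    obtain t where "exec c s t (f s)" "t \<le> poly p (s 0 0)" using p[OF s False] by blast
    then show ?thesis using False
      by (intro exI[of _ "1 + cost b + t"]) (auto intro: exec.IfTrue simp del: One_nat_def)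
  qed
  then show ?thesis unfolding runs_def by blast
qed

text \<open>\<open>g\<close> is a closed form of the whole loop: a round does not change what
  \<open>g\<close> predicts, and at the exit \<open>g\<close> is the identity. The measure bounds
  the number of rounds.\<close>

lemma runs_While:
  fixes \<mu> :: "state \<Rightarrow> nat"
  assumes c: "runs (\<lambda>s. I s \<and> val b s \<noteq> 0) c f"
    and step: "\<And>s. I s \<Longrightarrow> val b s \<noteq> 0 \<Longrightarrow>
      I (f s) \<and> \<mu> (f s) < \<mu> s \<and> f s 0 0 = s 0 0 \<and> g (f s) = g s"
    and exit: "\<And>s. I s \<Longrightarrow> val b s = 0 \<Longrightarrow> g s = s"
    and bound: "\<And>s. I s \<Longrightarrow> \<mu> s \<le> poly q (s 0 0)"
  shows "runs I (While b c) g"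
proof -
  obtain p where p: "\<And>s. I s \<Longrightarrow> val b s \<noteq> 0 \<Longrightarrow> \<exists>t. exec c s t (f s) \<and> t \<le> poly p (s 0 0)"
    using c unfolding runs_def by blast
  \<comment> \<open>The factor \<open>Suc (\<mu> s)\<close> bounds the number of tests, including
    the final failing one.\<close>
  have *: "\<exists>t. exec (While b c) s t (g s) \<and> t \<le> Suc (\<mu> s) * (1 + cost b + poly p (s 0 0))"
    if "I s" for s
    using that
  proof (induction "\<mu> s" arbitrary: s rule: less_induct)
    case less
    show ?case
    proof (cases "val b s = 0")
      case True
      then show ?thesis using exec.WhileFalse[OF True, of c] exit[OF less.prems True]
        by (intro exI[of _ "1 + cost b"]) auto
    next
      case False
      have f: "I (f s)" "\<mu> (f s) < \<mu> s" "f s 0 0 = s 0 0" "g (f s) = g s"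
        using step[OF less.prems False] by auto
      obtain t where t: "exec c s t (f s)" "t \<le> poly p (s 0 0)" using p[OF less.prems False] by blast
      obtain u where u: "exec (While b c) (f s) u (g s)"
        "u \<le> Suc (\<mu> (f s)) * (1 + cost b + poly p (s 0 0))"
        using less.hyps[OF f(2,1)] f(3,4) by auto
      have "exec (While b c) s (1 + cost b + t + u) (g s)"
        by (rule exec.WhileTrue[OF False t(1) u(1)])
      moreover have "u \<le> \<mu> s * (1 + cost b + poly p (s 0 0))"
        using u(2) f(2) by (meson Suc_leI le_trans mult_le_mono1)
      ultimately show ?thesis using t(2)
        by (intro exI[of _ "1 + cost b + t + u"]) auto
    qed
  qed
  have "\<exists>t. exec (While b c) s t (g s) \<and>
      t \<le> poly ((q + [:1:]) * ([:1 + cost b:] + p)) (s 0 0)" if "I s" for s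
  proof -
    obtain t where t: "exec (While b c) s t (g s)" "t \<le> Suc (\<mu> s) * (1 + cost b + poly p (s 0 0))"
      using *[OF \<open>I s\<close>] by blast
    note t(2)
    also have "Suc (\<mu> s) * (1 + cost b + poly p (s 0 0)) \<le>
        (poly q (s 0 0) + 1) * (1 + cost b + poly p (s 0 0))"
      using bound[OF \<open>I s\<close>] by (intro mult_le_mono1) simp
    finally show ?thesis using t(1) by (auto simp: algebra_simps)
  qed
  then show ?thesis unfolding runs_def by blast
qed

text \<open>
  The loop variable counts down, so that it is again 0 after the loop.  Together with resetting
  the result cell (array 5) this makes the final memory an explicit function of the initial one.
\<close>

definition For :: "nat \<Rightarrow> exp \<Rightarrow> com \<Rightarrow> com" where
  "For v e c = Seq (Assign v (Const 0) e)
     (While (V v) (Seq (Assign v (Const 0) (Sub (V v) (Const 1))) c))"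

text \<open>The counter only has to be at most \<open>i\<close> after the body, so the body may
  lower it further to leave the loop early.\<close>

lemma runs_For:
  assumes c: "runs P c f" and v: "v \<noteq> 0"
    and init: "\<And>s. Q s \<Longrightarrow> I (setv v (val e s) s)"
    and bound: "\<And>s. I s \<Longrightarrow> s v 0 \<le> poly q (s 0 0)"
    and step: "\<And>s i. I s \<Longrightarrow> s v 0 = Suc i \<Longrightarrow> P (setv v i s) \<and> I (f (setv v i s)) \<and>
      f (setv v i s) v 0 \<le> i \<and> f (setv v i s) 0 0 = s 0 0 \<and> g (f (setv v i s)) = g s"
    and exit: "\<And>s. I s \<Longrightarrow> s v 0 = 0 \<Longrightarrow> g s = s"
  shows "runs Q (For v e c) (\<lambda>s. g (setv v (val e s) s))"
  unfolding For_def
proof (rule runs_Seq[OF runs_setv, where Q = I])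
  have dec: "runs (\<lambda>s. I s \<and> val (V v) s \<noteq> 0) (Seq (Assign v (Const 0) (Sub (V v) (Const 1))) c)
      (\<lambda>s. f (setv v (val (Sub (V v) (Const 1)) s) s))"
  proof (rule runs_Seq[OF runs_setv c])
    fix s assume "I s \<and> val (V v) s \<noteq> 0"
    then obtain i where "I s" "s v 0 = Suc i" by (auto simp: gr0_conv_Suc)
    then show "P (setv v (val (Sub (V v) (Const 1)) s) s)" using step by simp
  qed (use v in \<open>simp add: setv_apply\<close>)
  show "runs I (While (V v) (Seq (Assign v (Const 0) (Sub (V v) (Const 1))) c)) g"
  proof (rule runs_While[OF dec, where \<mu> = "\<lambda>s. s v 0" and q = q])
    fix s assume "I s" "val (V v) s \<noteq> 0"
    then obtain i where "I s" "s v 0 = Suc i" by (auto simp: gr0_conv_Suc)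
    from step[OF this] show "I (f (setv v (val (Sub (V v) (Const 1)) s) s)) \<and>
       f (setv v (val (Sub (V v) (Const 1)) s) s) v 0 < s v 0 \<and>
       f (setv v (val (Sub (V v) (Const 1)) s) s) 0 0 = s 0 0 \<and>
       g (f (setv v (val (Sub (V v) (Const 1)) s) s)) = g s"
      using \<open>s v 0 = Suc i\<close> by auto
  qed (use bound exit in simp_all)
qed (use init v in \<open>simp_all add: setv_apply\<close>)

section \<open>Formulas with bounded quantifiers and the programs evaluating them\<close>

datatype fm = Tst exp | Neg fm | Con fm fm | Ex nat fm

primrec sat :: "fm \<Rightarrow> state \<Rightarrow> bool" where
  "sat (Tst e) s \<longleftrightarrow> val e s \<noteq> 0"
| "sat (Neg \<phi>) s \<longleftrightarrow> \<not> sat \<phi> s"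
| "sat (Con \<phi> \<psi>) s \<longleftrightarrow> sat \<phi> s \<and> sat \<psi> s"
| "sat (Ex v \<phi>) s \<longleftrightarrow> (\<exists>i < s 0 0. sat \<phi> (setv v i s))"

text \<open>The truth value is left in array 5. On finding a witness, the loop for \<open>Ex\<close>
  sets its own counter to 0, so it stops with the value 1 still in array 5.\<close>

primrec compile :: "fm \<Rightarrow> com" where
  "compile (Tst e) = If e (Assign 5 (Const 0) (Const 1)) (Assign 5 (Const 0) (Const 0))"
| "compile (Neg \<phi>) = Seq (compile \<phi>) (Assign 5 (Const 0) (Sub (Const 1) (V 5)))"
| "compile (Con \<phi> \<psi>) = Seq (compile \<phi>) (If (V 5) (compile \<psi>) Skip)"
| "compile (Ex v \<phi>) = Seq (Assign 5 (Const 0) (Const 0))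
     (For v (V 0) (Seq (compile \<phi>) (If (V 5) (Assign v (Const 0) (Const 0)) Skip)))"

primrec reads :: "exp \<Rightarrow> nat set" where
  "reads (Const k) = {}"
| "reads (Cell a e) = insert a (reads e)"
| "reads (Add e f) = reads e \<union> reads f"
| "reads (Sub e f) = reads e \<union> reads f"

primrec fm_reads :: "fm \<Rightarrow> nat set" where
  "fm_reads (Tst e) = reads e"
| "fm_reads (Neg \<phi>) = fm_reads \<phi>"
| "fm_reads (Con \<phi> \<psi>) = fm_reads \<phi> \<union> fm_reads \<psi>"
| "fm_reads (Ex v \<phi>) = insert 0 (fm_reads \<phi>)"

primrec bound_vars :: "fm \<Rightarrow> nat set" where
  "bound_vars (Tst e) = {}"
| "bound_vars (Neg \<phi>) = bound_vars \<phi>"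
| "bound_vars (Con \<phi> \<psi>) = bound_vars \<phi> \<union> bound_vars \<psi>"
| "bound_vars (Ex v \<phi>) = insert v (bound_vars \<phi>)"

text \<open>Nested quantifiers need different registers because an inner loop overwrites its
  counter, and no test may read the result register.\<close>

primrec wf_fm :: "fm \<Rightarrow> bool" where
  "wf_fm (Tst e) \<longleftrightarrow> 5 \<notin> reads e"
| "wf_fm (Neg \<phi>) \<longleftrightarrow> wf_fm \<phi>"
| "wf_fm (Con \<phi> \<psi>) \<longleftrightarrow> wf_fm \<phi> \<and> wf_fm \<psi>"
| "wf_fm (Ex v \<phi>) \<longleftrightarrow> v \<notin> {0, 5} \<and> v \<notin> bound_vars \<phi> \<and> wf_fm \<phi>"

lemma val_cong: "(\<And>a. a \<in> reads e \<Longrightarrow> s a = s' a) \<Longrightarrow> val e s = val e s'"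
  by (induction e) auto

lemma sat_cong: "(\<And>a. a \<in> fm_reads \<phi> \<Longrightarrow> s a = s' a) \<Longrightarrow> sat \<phi> s = sat \<phi> s'"
proof (induction \<phi> arbitrary: s s')
  case (Tst e)
  have "val e s = val e s'" by (rule val_cong) (simp add: Tst.prems)
  then show ?case by simp
next
  case (Neg \<phi>)
  have "sat \<phi> s = sat \<phi> s'" by (rule Neg.IH) (simp add: Neg.prems)
  then show ?case by simp
next
  case (Con \<phi> \<psi>)
  have "sat \<phi> s = sat \<phi> s'" by (rule Con.IH(1)) (simp add: Con.prems)
  moreover have "sat \<psi> s = sat \<psi> s'" by (rule Con.IH(2)) (simp add: Con.prems)
  ultimately show ?case by simp
next
  case (Ex v \<phi>)
  have "s 0 = s' 0" by (rule Ex.prems) simp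
  moreover have "sat \<phi> (setv v i s) = sat \<phi> (setv v i s')" for i
  proof (rule Ex.IH)
    fix a assume "a \<in> fm_reads \<phi>"
    then have "s a = s' a" using Ex.prems by simp
    then show "setv v i s a = setv v i s' a" by (auto simp: setv_apply)
  qed
  ultimately show ?case by simp
qed

lemma wf_fm_reads: "wf_fm \<phi> \<Longrightarrow> 5 \<notin> fm_reads \<phi> \<and> 0 \<notin> bound_vars \<phi> \<and> 5 \<notin> bound_vars \<phi>"
  by (induction \<phi>) auto

lemma sat_setv5 [simp]: "wf_fm \<phi> \<Longrightarrow> sat \<phi> (setv 5 x s) = sat \<phi> s"
  by (rule sat_cong) (use wf_fm_reads in \<open>auto simp: setv_apply\<close>)

definition zero_on :: "nat set \<Rightarrow> state \<Rightarrow> bool" where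
  "zero_on W s \<longleftrightarrow> (\<forall>w\<in>W. s w 0 = 0)"

lemma zero_on_setv: "w \<notin> W \<Longrightarrow> zero_on W (setv w x s) = zero_on W s"
  by (auto simp: zero_on_def setv_apply)

text \<open>Loop registers are 0 before and after, so the only net change is in array 5.\<close>

lemma runs_compile:
  "wf_fm \<phi> \<Longrightarrow> runs (zero_on (bound_vars \<phi>)) (compile \<phi>) (\<lambda>s. setv 5 (of_bool (sat \<phi> s)) s)"
proof (induction \<phi>)
  case (Tst e)
  show ?case unfolding compile.simps
    by (rule runs_cong[OF runs_If[OF runs_setv runs_setv], where P = "\<lambda>_. True"]) auto
next
  case (Neg \<phi>)
  show ?case unfolding compile.simps
    by (rule runs_cong[OF runs_Seq[OF Neg.IH runs_setv[of "\<lambda>_. True"]]])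
      (use Neg.prems in \<open>auto simp: setv_apply\<close>)
next
  case (Con \<phi> \<psi>)
  have w: "wf_fm \<phi>" "wf_fm \<psi>" using Con.prems by auto
  let ?Z = "zero_on (bound_vars (Con \<phi> \<psi>))"
  have 2: "runs (zero_on (bound_vars \<psi>)) (If (V 5) (compile \<psi>) Skip)
      (\<lambda>s. if val (V 5) s \<noteq> 0 then setv 5 (of_bool (sat \<psi> s)) s else s)"
    by (rule runs_If[OF runs_cong[OF Con.IH(2)[OF w(2)]] runs_Skip]) auto
  have 1: "runs ?Z (compile \<phi>) (\<lambda>s. setv 5 (of_bool (sat \<phi> s)) s)"
    by (rule runs_cong[OF Con.IH(1)[OF w(1)]]) (auto simp: zero_on_def)
  have z: "zero_on (bound_vars \<psi>) (setv 5 x s)" if "?Z s" for x s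
    using that wf_fm_reads[OF w(2)] by (auto simp: zero_on_def setv_apply)
  have c: "setv 5 x s 0 0 = s 0 0" for x s by (simp add: setv_apply)
  show ?case unfolding compile.simps
  proof (rule runs_cong[OF runs_Seq[OF 1 2 z c]])
    fix s
    show "(if val (V 5) (setv 5 (of_bool (sat \<phi> s)) s) \<noteq> 0
        then setv 5 (of_bool (sat \<psi> (setv 5 (of_bool (sat \<phi> s)) s))) (setv 5 (of_bool (sat \<phi> s)) s)
        else setv 5 (of_bool (sat \<phi> s)) s) = setv 5 (of_bool (sat (Con \<phi> \<psi>) s)) s"
      using w by (cases "sat \<phi> s") (simp_all add: setv_apply)
  qed
next
  case (Ex v \<phi>)
  have w: "wf_fm \<phi>" and v: "v \<noteq> 0" "v \<noteq> 5" "v \<notin> bound_vars \<phi>" using Ex.prems by auto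
  have b: "0 \<notin> bound_vars \<phi>" "5 \<notin> bound_vars \<phi>" using wf_fm_reads[OF w] by auto
  let ?Z = "zero_on (bound_vars \<phi>)"
  let ?f = "\<lambda>s. if sat \<phi> s then setv v 0 (setv 5 1 s) else setv 5 0 s"
  \<comment> \<open>The effect of the remaining rounds. With counter 0 the value in array 5 is final
    and is kept; otherwise it becomes whether a witness lies below the counter.\<close>
  let ?g = "\<lambda>s. if s v 0 = 0 then s
     else setv v 0 (setv 5 (of_bool (\<exists>i < s v 0. sat \<phi> (setv v i s))) s)"
  have exit: "runs (\<lambda>_. True) (If (V 5) (Assign v (Const 0) (Const 0)) Skip)
      (\<lambda>s. if val (V 5) s \<noteq> 0 then setv v (val (Const 0) s) s else s)"
    by (rule runs_If[OF runs_setv runs_Skip])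
  have body: "runs ?Z (Seq (compile \<phi>) (If (V 5) (Assign v (Const 0) (Const 0)) Skip)) ?f"
  proof (rule runs_cong[OF runs_Seq[OF Ex.IH[OF w] exit]])
    fix s
    show "(if val (V 5) (setv 5 (of_bool (sat \<phi> s)) s) \<noteq> 0
        then setv v (val (Const 0) (setv 5 (of_bool (sat \<phi> s)) s)) (setv 5 (of_bool (sat \<phi> s)) s)
        else setv 5 (of_bool (sat \<phi> s)) s) = ?f s"
      by (cases "sat \<phi> s") (simp_all add: setv_apply)
  qed (simp_all add: setv_apply)
  have loop: "runs ?Z (For v (V 0) (Seq (compile \<phi>) (If (V 5) (Assign v (Const 0) (Const 0)) Skip)))
      (\<lambda>s. ?g (setv v (val (V 0) s) s))"
  proof (rule runs_For[OF body v(1), where I = "\<lambda>s. ?Z s \<and> s v 0 \<le> s 0 0" and q = "[:0, 1:]"])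
    fix s i assume I: "?Z s \<and> s v 0 \<le> s 0 0" and i: "s v 0 = Suc i"
    have "?g (?f (setv v i s)) = ?g s"
    proof -
      have sw: "setv 5 x (setv v y r) = setv v y (setv 5 x r)" for x y r
        using v by (intro setv_swap) simp
      have v0: "setv v y r v 0 = y" "setv 5 x r v = r v" for x y r
        using v by (simp_all add: setv_apply)
      have ex: "(\<exists>j<Suc i. sat \<phi> (setv v j s)) \<longleftrightarrow> sat \<phi> (setv v i s) \<or> (\<exists>j<i. sat \<phi> (setv v j s))"
        by (auto simp: less_Suc_eq)
      have st: "sat \<phi> (setv v j (setv 5 x r)) = sat \<phi> (setv v j r)" for j x r
        using w by (simp flip: sw)
      show ?thesis
        unfolding i ex by (cases "sat \<phi> (setv v i s)"; cases "i = 0") (simp_all add: sw v0 st)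
    qed
    then show "?Z (setv v i s) \<and> (?Z (?f (setv v i s)) \<and> ?f (setv v i s) v 0 \<le> ?f (setv v i s) 0 0) \<and>
      ?f (setv v i s) v 0 \<le> i \<and> ?f (setv v i s) 0 0 = s 0 0 \<and> ?g (?f (setv v i s)) = ?g s"
      using v b I i by (auto simp: setv_apply zero_on_setv)
  qed (use v in \<open>auto simp: setv_apply zero_on_setv\<close>)
  show ?case unfolding compile.simps
  proof (rule runs_cong[OF runs_Seq[OF runs_setv[of "zero_on (bound_vars (Ex v \<phi>))"] loop]])
    fix s assume z: "zero_on (bound_vars (Ex v \<phi>)) s"
    show "?Z (setv 5 (val (Const 0) s) s)" using z b by (simp add: zero_on_setv) (simp add: zero_on_def)
    have sw: "setv 5 x (setv v y r) = setv v y (setv 5 x r)" for x y r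
      using v by (intro setv_swap) simp
    have st: "sat \<phi> (setv v j (setv 5 x r)) = sat \<phi> (setv v j r)" for j x r
      using w by (simp flip: sw)
    have 0: "setv v 0 s = s" using z by (intro setv_same) (simp add: zero_on_def)
    have v0: "setv v y r v 0 = y" "setv 5 x r 0 = r 0" "setv 5 x r v = r v" for x y r
      using v by (simp_all add: setv_apply)
    have "s v 0 = 0" using z by (simp add: zero_on_def)
    note v0 = v0 this
    have sw': "setv v 0 (setv 5 x s) = setv 5 x s" for x using sw[of x 0 s] 0 by simp
    have "setv v 0 (setv 5 0 s) = setv 5 0 s" by (rule sw')
    then show "?g (setv v (val (V 0) (setv 5 (val (Const 0) s) s)) (setv 5 (val (Const 0) s) s)) =
        setv 5 (of_bool (sat (Ex v \<phi>) s)) s"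
      by (cases "s 0 0 = 0") (simp_all add: v0 st sw sw')
  qed (simp_all add: setv_apply)
qed

text \<open>
  Without multiplication, a cell of a matrix is addressed by the multiples of \<open>n\<close> stored in
  array 4.  The matrices on literals have \<open>2 * n\<close> columns.
\<close>

definition idx :: "exp \<Rightarrow> exp \<Rightarrow> exp" where
  "idx l m = Add (Add (Cell 4 l) (Cell 4 l)) m"

definition row_offsets :: "state \<Rightarrow> bool" where
  "row_offsets s \<longleftrightarrow> (\<forall>i \<le> 2 * s 0 0. s 4 i = i * s 0 0)"

section \<open>Filling a matrix entry by entry from a formula\<close>

definition tabulate :: "nat \<Rightarrow> fm \<Rightarrow> com" where
  "tabulate y \<phi> = For 8 (Add (V 0) (V 0)) (For 9 (Add (V 0) (V 0))
     (Seq (compile \<phi>) (Seq (Assign y (idx (V 8) (V 9)) (V 5)) (Assign 5 (Const 0) (Const 0)))))"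

text \<open>The flat index \<open>k\<close> stands for row \<open>k div (2 * n)\<close> and column
  \<open>k mod (2 * n)\<close>. For \<open>n = 0\<close> the division yields 0, which is not below
  0, so \<open>X\<close> is unchanged.\<close>

definition table :: "nat \<Rightarrow> (nat \<Rightarrow> nat \<Rightarrow> bool) \<Rightarrow> (nat \<Rightarrow> nat) \<Rightarrow> nat \<Rightarrow> nat" where
  "table n R X k = (if k div (2 * n) < 2 * n then of_bool (R (k div (2 * n)) (k mod (2 * n))) else X k)"

text \<open>The formula must not read the target array \<open>y\<close>; hence entries written
  earlier do not influence later ones.\<close>

lemma runs_tabulate:
  assumes w: "wf_fm \<phi>" and y: "y \<notin> {0, 4, 5, 8, 9} \<union> bound_vars \<phi> \<union> fm_reads \<phi>"
    and b: "bound_vars \<phi> \<inter> {4, 8, 9} = {}"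
  shows "runs (\<lambda>s. row_offsets s \<and> zero_on (bound_vars \<phi> \<union> {5, 8, 9}) s) (tabulate y \<phi>)
    (\<lambda>s. s(y := table (s 0 0) (\<lambda>l m. sat \<phi> (setv 9 m (setv 8 l s))) (s y)))"
proof -
  note b5 = wf_fm_reads[OF w]
  let ?W = "bound_vars \<phi> \<union> {5}"
  let ?P = "\<lambda>s. row_offsets s \<and> zero_on ?W s \<and> s 8 0 < 2 * s 0 0"
  let ?f = "\<lambda>s. s(y := (s y)(s 8 0 * (2 * s 0 0) + s 9 0 := of_bool (sat \<phi> s)))"
  have ro: "row_offsets (s(a := x)) = row_offsets s" if "a \<noteq> 0" "a \<noteq> 4" for s a x
    using that by (auto simp: row_offsets_def)
  have ro': "row_offsets (setv a x s) = row_offsets s" if "a \<noteq> 0" "a \<noteq> 4" for s a x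
    unfolding setv_def by (rule ro[OF that])
  have sy: "sat \<phi> (setv v i (setv v' i' (s(y := x)))) = sat \<phi> (setv v i (setv v' i' s))"
    if "v \<noteq> y" "v' \<noteq> y" for s x v i v' i'
    using y that by (intro sat_cong) (auto simp: setv_apply)
  have sy1: "sat \<phi> (setv v i (s(y := x))) = sat \<phi> (setv v i s)" if "v \<noteq> y" for s x v i
    using y that by (intro sat_cong) (auto simp: setv_apply)
  let ?i = "idx (V 8) (V 9)"
  let ?h = "\<lambda>s. s(y := (s y)(val ?i s := val (V 5) s))"
  have 2: "runs (\<lambda>_. True) (Seq (Assign y ?i (V 5)) (Assign 5 (Const 0) (Const 0)))
      (\<lambda>s. setv 5 (val (Const 0) (?h s)) (?h s))"
    by (rule runs_Seq[OF runs_Assign runs_setv[of "\<lambda>_. True"]]) (use y in auto)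
  have 1: "runs ?P (compile \<phi>) (\<lambda>s. setv 5 (of_bool (sat \<phi> s)) s)"
    by (rule runs_cong[OF runs_compile[OF w]]) (auto simp: zero_on_def)
  have body: "runs ?P (Seq (compile \<phi>) (Seq (Assign y ?i (V 5)) (Assign 5 (Const 0) (Const 0)))) ?f"
  proof (rule runs_cong[OF runs_Seq[OF 1 2]])
    fix s assume P: "?P s"
    let ?s = "setv 5 (of_bool (sat \<phi> s)) s"
    have "4 \<noteq> (5::nat)" "8 \<noteq> (5::nat)" "9 \<noteq> (5::nat)" by simp_all
    then have "val ?i ?s = s 4 (s 8 0) + s 4 (s 8 0) + s 9 0"
      by (simp only: idx_def setv_apply val.simps if_False)
    also have "s 4 (s 8 0) = s 8 0 * s 0 0" using P by (simp add: row_offsets_def)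
    finally have i: "val ?i ?s = s 8 0 * (2 * s 0 0) + s 9 0" by simp
    show "setv 5 (val (Const 0) (?h ?s)) (?h ?s) = ?f s"
      unfolding i using P y by (auto simp: setv_def zero_on_def fun_eq_iff)
  qed (simp_all add: setv_apply)
  \<comment> \<open>What the inner loop still has to do: fill the cells of the current row whose
    column is below the counter.\<close>
  let ?gi = "\<lambda>s. setv 9 0 (s(y := (\<lambda>k. if k div (2 * s 0 0) = s 8 0 \<and> k mod (2 * s 0 0) < s 9 0
      then of_bool (sat \<phi> (setv 9 (k mod (2 * s 0 0)) s)) else s y k)))"
  have inner: "runs (\<lambda>s. ?P s) (For 9 (Add (V 0) (V 0))
     (Seq (compile \<phi>) (Seq (Assign y (idx (V 8) (V 9)) (V 5)) (Assign 5 (Const 0) (Const 0)))))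
     (\<lambda>s. ?gi (setv 9 (val (Add (V 0) (V 0)) s) s))"
  proof (rule runs_For[OF body, where I = "\<lambda>s. ?P s \<and> s 9 0 \<le> 2 * s 0 0" and q = "[:0, 2:]"])
    fix s i assume I: "?P s \<and> s 9 0 \<le> 2 * s 0 0" and i: "s 9 0 = Suc i"
    have k: "k = s 8 0 * (2 * s 0 0) + i \<longleftrightarrow> k div (2 * s 0 0) = s 8 0 \<and> k mod (2 * s 0 0) = i" for k
    proof
      assume "k = s 8 0 * (2 * s 0 0) + i"
      then show "k div (2 * s 0 0) = s 8 0 \<and> k mod (2 * s 0 0) = i" using I i by simp
    next
      assume "k div (2 * s 0 0) = s 8 0 \<and> k mod (2 * s 0 0) = i"
      then show "k = s 8 0 * (2 * s 0 0) + i" using div_mult_mod_eq[of k "2 * s 0 0"] by simp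
    qed
    have "?gi (?f (setv 9 i s)) = ?gi s"
      using y i k by (auto simp: setv_apply sy1 fun_eq_iff less_Suc_eq)
    then show "?P (setv 9 i s) \<and> (?P (?f (setv 9 i s)) \<and> ?f (setv 9 i s) 9 0 \<le> 2 * ?f (setv 9 i s) 0 0) \<and>
      ?f (setv 9 i s) 9 0 \<le> i \<and> ?f (setv 9 i s) 0 0 = s 0 0 \<and> ?gi (?f (setv 9 i s)) = ?gi s"
      using y b b5 I i by (auto simp: setv_apply ro ro' zero_on_def)
  qed (use y b b5 in \<open>auto simp: setv_apply ro ro' zero_on_def fun_eq_iff\<close>)
  let ?f' = "\<lambda>s. s(y := (\<lambda>k. if k div (2 * s 0 0) = s 8 0
      then of_bool (sat \<phi> (setv 9 (k mod (2 * s 0 0)) s)) else s y k))"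
  let ?P' = "\<lambda>s. row_offsets s \<and> zero_on (?W \<union> {9}) s \<and> s 8 0 < 2 * s 0 0"
  have row: "runs ?P' (For 9 (Add (V 0) (V 0))
     (Seq (compile \<phi>) (Seq (Assign y ?i (V 5)) (Assign 5 (Const 0) (Const 0))))) ?f'"
  proof (rule runs_cong[OF inner])
    fix s assume P: "?P' s"
    define N where "N = 2 * s 0 0"
    have N: "k mod N < N" for k using P by (simp add: N_def)
    have v: "val (Add (V 0) (V 0)) s = N" by (simp add: N_def)
    have "setv 9 0 s = s" using P by (intro setv_same) (simp add: zero_on_def)
    moreover have "setv 9 N s 8 = s 8" "setv 9 N s 0 = s 0" "setv 9 N s y = s y" "setv 9 N s 9 0 = N"
      "2 * setv 9 N s 0 0 = N" "\<And>j. setv 9 j (setv 9 N s) = setv 9 j s"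
      using y by (simp_all add: setv_apply N_def)
    moreover have "setv 9 0 ((setv 9 N s)(y := X)) = (setv 9 0 s)(y := X)" for X
      using y by (auto simp: setv_def fun_eq_iff)
    ultimately show "?gi (setv 9 (val (Add (V 0) (V 0)) s) s) = ?f' s"
      unfolding v N_def[symmetric] by (simp add: N cong: if_cong)
  qed (simp_all add: zero_on_def)
  \<comment> \<open>Likewise for the outer loop: the rows below the counter are still to be
    filled.\<close>
  let ?go = "\<lambda>s. setv 8 0 (s(y := (\<lambda>k. if k div (2 * s 0 0) < s 8 0
      then of_bool (sat \<phi> (setv 9 (k mod (2 * s 0 0)) (setv 8 (k div (2 * s 0 0)) s))) else s y k)))"
  let ?I = "\<lambda>s. row_offsets s \<and> zero_on (?W \<union> {9}) s \<and> s 8 0 \<le> 2 * s 0 0"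
  have outer: "runs (\<lambda>s. row_offsets s \<and> zero_on (bound_vars \<phi> \<union> {5, 8, 9}) s) (tabulate y \<phi>)
    (\<lambda>s. ?go (setv 8 (val (Add (V 0) (V 0)) s) s))"
    unfolding tabulate_def
  proof (rule runs_For[OF row, where q = "[:0, 2:]" and I = ?I])
    fix s i
    assume I: "?I s" and i: "s 8 0 = Suc i"
    have s8: "setv 8 i s 0 = s 0" "setv 8 i s y = s y" "setv 8 i s 8 0 = i" using y by (simp_all add: setv_apply)
    have 1: "?f' (setv 8 i s) 8 0 = i" "?f' (setv 8 i s) 0 = s 0" using y s8 by simp_all
    have 2: "?P' (setv 8 i s)" "?I (?f' (setv 8 i s))"
      using y b b5 I i by (auto simp: setv_apply ro ro' zero_on_def)
    have "?go (?f' (setv 8 i s)) = ?go s"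
      using y i by (simp add: 1 s8 sy less_Suc_eq cong: if_cong) (auto simp: setv_def fun_eq_iff)
    with 1 2 show "?P' (setv 8 i s) \<and> ?I (?f' (setv 8 i s)) \<and>
      ?f' (setv 8 i s) 8 0 \<le> i \<and> ?f' (setv 8 i s) 0 0 = s 0 0 \<and> ?go (?f' (setv 8 i s)) = ?go s"
      by simp
  next
    show "?go s = s" if "?I s" "s 8 0 = 0" for s
      using that y by (auto simp: setv_def fun_eq_iff)
  qed (use y b b5 in \<open>auto simp: setv_apply ro ro' zero_on_def\<close>)
  show ?thesis
  proof (rule runs_cong[OF outer])
    fix s assume P: "row_offsets s \<and> zero_on (bound_vars \<phi> \<union> {5, 8, 9}) s"
    have s8: "setv 8 i s 0 = s 0" "setv 8 i s y = s y" "setv 8 i s 8 0 = i" for i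
      using y by (simp_all add: setv_apply)
    have "setv 8 0 ((setv 8 i s)(y := X)) = (setv 8 0 s)(y := X)" for i X
      using y by (auto simp: setv_def fun_eq_iff)
    moreover have "setv 8 0 s = s" using P by (intro setv_same) (simp add: zero_on_def)
    ultimately show "?go (setv 8 (val (Add (V 0) (V 0)) s) s) =
        s(y := table (s 0 0) (\<lambda>l m. sat \<phi> (setv 9 m (setv 8 l s))) (s y))"
      by (simp add: s8 table_def fun_eq_iff cong: if_cong)
  qed
qed


section \<open>The decision program\<close>

text \<open>
  Arrays 6 and 7 hold the clause matrix and its successor during an elimination step.  The remaining
  arrays are used as registers: 8 and 9 for the indices of the current matrix entry, 10 to 15 for
  quantified vertices, 16 for the variable being eliminated.
\<close>

definition offsets :: "nat \<Rightarrow> nat \<Rightarrow> nat" where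
  "offsets n k = (if k \<le> 2 * n then k * n else 0)"

text \<open>Each multiple of \<open>n\<close> is the previous one plus \<open>n\<close>, so rows are
  visited upwards while the counter runs down. After the decrement the row is \<open>2 * n\<close>
  minus the counter, starting at row 1; cell 0 is 0 already.\<close>

definition init_com :: com where
  "init_com = For 17 (Add (V 0) (V 0))
     (Assign 4 (Sub (Add (V 0) (V 0)) (V 17))
       (Add (Cell 4 (Sub (Sub (Add (V 0) (V 0)) (V 17)) (Const 1))) (V 0)))"

lemma runs_init_com:
  "runs (\<lambda>s. s 4 = (\<lambda>_. 0) \<and> s 17 0 = 0) init_com (\<lambda>s. s(4 := offsets (s 0 0)))"
proof -
  let ?f = "\<lambda>s :: state. s(4 := (s 4)(val (Sub (Add (V 0) (V 0)) (V 17)) s :=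
     val (Add (Cell 4 (Sub (Sub (Add (V 0) (V 0)) (V 17)) (Const 1))) (V 0)) s))"
  \<comment> \<open>\<open>?r\<close> is the last row whose offset is stored, and \<open>?g\<close>
    fills in those above it.\<close>
  let ?r = "\<lambda>s :: state. 2 * s 0 0 - s 17 0"
  let ?g = "\<lambda>s :: state. setv 17 0 (s(4 := (\<lambda>k. if ?r s < k \<and> k \<le> 2 * s 0 0
     then s 4 (?r s) + (k - ?r s) * s 0 0 else s 4 k)))"
  have "runs (\<lambda>s. s 4 = (\<lambda>_. 0) \<and> s 17 0 = 0) init_com (\<lambda>s. ?g (setv 17 (val (Add (V 0) (V 0)) s) s))"
    unfolding init_com_def
  proof (rule runs_For[OF runs_Assign, where q = "[:0, 2:]" and I = "\<lambda>s. s 17 0 \<le> 2 * s 0 0"])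
    fix s :: state and i assume I: "s 17 0 \<le> 2 * s 0 0" and i: "s 17 0 = Suc i"
    define N where "N = 2 * s 0 0"
    define r where "r = ?r s"
    have r: "N - i = Suc r" "Suc r \<le> N" using I i by (auto simp: r_def N_def)
    have f: "?f (setv 17 i s) = (setv 17 i s)(4 := (s 4)(Suc r := s 4 r + s 0 0))"
    proof -
      have "s 0 0 + s 0 0 - i = Suc r" "s 0 0 + s 0 0 - Suc i = r" using r by (simp_all add: N_def)
      then show ?thesis by (simp add: setv_apply)
    qed
    have *: "(if N - i < k \<and> k \<le> N then ((s 4)(Suc r := s 4 r + s 0 0)) (N - i) + (k - (N - i)) * s 0 0
        else ((s 4)(Suc r := s 4 r + s 0 0)) k) =
       (if r < k \<and> k \<le> N then s 4 r + (k - r) * s 0 0 else s 4 k)" for k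
    proof (cases "Suc r < k")
      case True
      then have "k - r = Suc (k - Suc r)" by simp
      then show ?thesis using True r by simp
    next
      case False
      then show ?thesis using r by (cases "k = Suc r") auto
    qed
    have "?g (?f (setv 17 i s)) = setv 17 0 (s(4 := (\<lambda>k. if N - i < k \<and> k \<le> N
        then ((s 4)(Suc r := s 4 r + s 0 0)) (N - i) + (k - (N - i)) * s 0 0
        else ((s 4)(Suc r := s 4 r + s 0 0)) k)))"
      unfolding f by (auto simp: setv_def N_def fun_eq_iff)
    also have "\<dots> = ?g s" by (simp only: *) (simp only: r_def N_def)
    finally have g: "?g (?f (setv 17 i s)) = ?g s" .
    have "?f (setv 17 i s) 17 0 = i" "?f (setv 17 i s) 0 = s 0"
      unfolding f by (simp_all add: setv_apply)
    then show "True \<and> ?f (setv 17 i s) 17 0 \<le> 2 * ?f (setv 17 i s) 0 0 \<and> ?f (setv 17 i s) 17 0 \<le> i \<and>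
       ?f (setv 17 i s) 0 0 = s 0 0 \<and> ?g (?f (setv 17 i s)) = ?g s"
      using g I i by simp
  next
    show "?g s = s" if "s 17 0 \<le> 2 * s 0 0" "s 17 0 = 0" for s
      using that by (auto simp: setv_def fun_eq_iff)
  qed (simp_all add: setv_apply)
  then show ?thesis
    by (rule runs_cong) (auto simp: setv_def offsets_def fun_eq_iff)
qed

section \<open>The conflicts of the 2-SAT instance as a formula\<close>

definition Dis :: "fm \<Rightarrow> fm \<Rightarrow> fm" where
  "Dis \<phi> \<psi> = Neg (Con (Neg \<phi>) (Neg \<psi>))"

text \<open>Subtraction is truncated, so both differences vanish only for equal values.\<close>

definition eq_fm :: "exp \<Rightarrow> exp \<Rightarrow> fm" where
  "eq_fm e f = Neg (Tst (Add (Sub e f) (Sub f e)))"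

definition adj_fm :: "exp \<Rightarrow> exp \<Rightarrow> fm" where
  "adj_fm e f = Tst (Cell 1 (Add (Cell 4 e) f))"

lemma sat_Dis [simp]: "sat (Dis \<phi> \<psi>) s \<longleftrightarrow> sat \<phi> s \<or> sat \<psi> s"
  by (simp add: Dis_def)

lemma sat_eq_fm [simp]: "sat (eq_fm e f) s \<longleftrightarrow> val e s = val f s"
  by (auto simp: eq_fm_def)

definition forced_fm :: "nat \<Rightarrow> nat \<Rightarrow> exp \<Rightarrow> fm" where
  "forced_fm a b x = Dis (Tst (Cell a x)) (Ex 14 (Ex 15 (
     Con (Tst (Cell a (V 14))) (Con (Tst (Cell b (V 15))) (Con (adj_fm (V 14) (V 15))
       (Con (adj_fm (V 14) x) (Con (Neg (eq_fm x (V 15))) (Neg (adj_fm (V 15) x)))))))))"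

definition neg_lit :: "exp \<Rightarrow> exp" where "neg_lit e = Add e (V 0)"

definition side_fm :: "nat \<Rightarrow> nat \<Rightarrow> exp \<Rightarrow> exp \<Rightarrow> fm" where
  "side_fm a b x l = Dis (forced_fm a b x) (Dis (eq_fm (V 8) l) (eq_fm (V 9) l))"

definition conflict_fm :: fm where
  "conflict_fm = Ex 10 (Ex 11 (Ex 12 (Ex 13 (
     Con (side_fm 2 3 (V 10) (V 10)) (Con (side_fm 2 3 (V 11) (V 11))
     (Con (side_fm 3 2 (V 12) (neg_lit (V 12))) (Con (side_fm 3 2 (V 13) (neg_lit (V 13)))
     (Dis (eq_fm (V 10) (V 12)) (Con (adj_fm (V 10) (V 12)) (Con (adj_fm (V 11) (V 13))
       (Dis (Con (Neg (eq_fm (V 10) (V 11))) (Neg (adj_fm (V 10) (V 11))))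
         (Con (Neg (eq_fm (V 12) (V 13))) (Neg (adj_fm (V 12) (V 13)))))))))))))))"

definition holds_instance :: "nat \<Rightarrow> nat rel \<Rightarrow> nat set \<Rightarrow> nat set \<Rightarrow> state \<Rightarrow> bool" where
  "holds_instance n E A B s \<longleftrightarrow> s 0 0 = n \<and> row_offsets s \<and>
     (\<forall>x<n. \<forall>y<n. s 1 (x * n + y) \<noteq> 0 \<longleftrightarrow> (x, y) \<in> E) \<and>
     (\<forall>x<n. s 2 x \<noteq> 0 \<longleftrightarrow> x \<in> A) \<and> (\<forall>x<n. s 3 x \<noteq> 0 \<longleftrightarrow> x \<in> B)"

lemma holds_instance_setv:
  assumes "4 < v"
  shows "holds_instance n E A B (setv v x s) = holds_instance n E A B s"
proof -
  have "setv v x s a = s a" if "a \<le> 4" for a using assms that by (simp add: setv_apply)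
  from this[of 0] this[of 1] this[of 2] this[of 3] this[of 4] show ?thesis
    by (simp add: holds_instance_def row_offsets_def)
qed

lemma sat_adj_fm:
  assumes "holds_instance n E A B s" "val e s < n" "val f s < n"
  shows "sat (adj_fm e f) s \<longleftrightarrow> (val e s, val f s) \<in> E"
  using assms by (simp add: adj_fm_def holds_instance_def row_offsets_def)

text \<open>Quantifiers range over numbers below \<open>n\<close>, which loses nothing as
  \<open>A\<close> and \<open>B\<close> lie there. Registers 14 and 15 are bound inside the formula,
  so \<open>x\<close> has to be another one.\<close>

lemma sat_forced_fm:
  assumes s: "holds_instance n E A B s" and AB: "A \<subseteq> {..<n}" "B \<subseteq> {..<n}"
    and x: "x \<notin> {14, 15}" "s x 0 < n"
  shows "sat (forced_fm 2 3 (V x)) s \<longleftrightarrow> forced E A B (s x 0)"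
    and "sat (forced_fm 3 2 (V x)) s \<longleftrightarrow> forced E B A (s x 0)"
proof -
  have n: "s 0 0 = n" using s by (simp add: holds_instance_def)
  have A: "s 2 y \<noteq> 0 \<longleftrightarrow> y \<in> A" "s 3 y \<noteq> 0 \<longleftrightarrow> y \<in> B" if "y < n" for y
    using s that by (simp_all add: holds_instance_def)
  let ?s = "\<lambda>a b. setv 15 b (setv 14 a s)"
  have i: "holds_instance n E A B (?s a b)" for a b using s by (simp add: holds_instance_setv)
  have v: "?s a b 14 0 = a" "?s a b 15 0 = b" "?s a b x = s x" "?s a b 0 = s 0"
    "?s a b 2 = s 2" "?s a b 3 = s 3" "setv 14 a s 0 = s 0" for a b
    using x by (simp_all add: setv_apply)
  have adj: "sat (adj_fm (V 14) (V 15)) (?s a b) \<longleftrightarrow> (a, b) \<in> E"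
    "sat (adj_fm (V 14) (V x)) (?s a b) \<longleftrightarrow> (a, s x 0) \<in> E"
    "sat (adj_fm (V 15) (V x)) (?s a b) \<longleftrightarrow> (b, s x 0) \<in> E" if "a < n" "b < n" for a b
    using that x(2) sat_adj_fm[OF i] by (simp_all add: v)
  have "sat (forced_fm 2 3 (V x)) s \<longleftrightarrow> s x 0 \<in> A \<or> (\<exists>a<n. \<exists>b<n. a \<in> A \<and> b \<in> B \<and>
      (a, b) \<in> E \<and> (a, s x 0) \<in> E \<and> s x 0 \<noteq> b \<and> (b, s x 0) \<notin> E)"
    unfolding forced_fm_def
    by (simp only: sat.simps sat_Dis sat_eq_fm val.simps v n A x(2) adj cong: conj_cong)
  then show "sat (forced_fm 2 3 (V x)) s \<longleftrightarrow> forced E A B (s x 0)"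
    unfolding forced_def using AB by blast
  have "sat (forced_fm 3 2 (V x)) s \<longleftrightarrow> s x 0 \<in> B \<or> (\<exists>a<n. \<exists>b<n. a \<in> B \<and> b \<in> A \<and>
      (a, b) \<in> E \<and> (a, s x 0) \<in> E \<and> s x 0 \<noteq> b \<and> (b, s x 0) \<notin> E)"
    unfolding forced_fm_def
    by (simp only: sat.simps sat_Dis sat_eq_fm val.simps v n A x(2) adj cong: conj_cong)
  then show "sat (forced_fm 3 2 (V x)) s \<longleftrightarrow> forced E B A (s x 0)"
    unfolding forced_def using AB by blast
qed

lemma sat_conflict_fm:
  assumes s: "holds_instance n E A B s" and AB: "A \<subseteq> {..<n}" "B \<subseteq> {..<n}"
  shows "sat conflict_fm (setv 9 m (setv 8 l s)) \<longleftrightarrow> conflict n E A B l m"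
proof -
  let ?base = "setv 9 m (setv 8 l s)"
  let ?s = "\<lambda>x x' y y'. setv 13 y' (setv 12 y (setv 11 x' (setv 10 x ?base)))"
  have i: "holds_instance n E A B (?s x x' y y')" for x x' y y'
    using s by (simp add: holds_instance_setv)
  have v: "?s x x' y y' 10 0 = x" "?s x x' y y' 11 0 = x'" "?s x x' y y' 12 0 = y"
    "?s x x' y y' 13 0 = y'" "?s x x' y y' 8 0 = l" "?s x x' y y' 9 0 = m" "?s x x' y y' 0 0 = n"
    for x x' y y'
    using i[of x x' y y'] by (simp_all add: setv_apply holds_instance_def)
  have v': "?base 0 0 = n" "setv 10 x ?base 0 0 = n" "setv 11 x' (setv 10 x ?base) 0 0 = n"
    "setv 12 y (setv 11 x' (setv 10 x ?base)) 0 0 = n" for x x' y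
    using s by (simp_all add: setv_apply holds_instance_def)
  have forced: "sat (forced_fm 2 3 (V 10)) (?s x x' y y') \<longleftrightarrow> forced E A B x"
    "sat (forced_fm 2 3 (V 11)) (?s x x' y y') \<longleftrightarrow> forced E A B x'"
    "sat (forced_fm 3 2 (V 12)) (?s x x' y y') \<longleftrightarrow> forced E B A y"
    "sat (forced_fm 3 2 (V 13)) (?s x x' y y') \<longleftrightarrow> forced E B A y'"
    if "x < n" "x' < n" "y < n" "y' < n" for x x' y y'
    using that sat_forced_fm[OF i[of y' y x' x] AB, of 10] sat_forced_fm[OF i[of y' y x' x] AB, of 11]
      sat_forced_fm[OF i[of y' y x' x] AB, of 12] sat_forced_fm[OF i[of y' y x' x] AB, of 13]
    unfolding v by simp_all
  have adj: "sat (adj_fm (V 10) (V 12)) (?s x x' y y') \<longleftrightarrow> (x, y) \<in> E"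
    "sat (adj_fm (V 11) (V 13)) (?s x x' y y') \<longleftrightarrow> (x', y') \<in> E"
    "sat (adj_fm (V 10) (V 11)) (?s x x' y y') \<longleftrightarrow> (x, x') \<in> E"
    "sat (adj_fm (V 12) (V 13)) (?s x x' y y') \<longleftrightarrow> (y, y') \<in> E"
    if "x < n" "x' < n" "y < n" "y' < n" for x x' y y'
    using that sat_adj_fm[OF i] by (simp_all add: v)
  have "sat conflict_fm ?base \<longleftrightarrow> (\<exists>x<n. \<exists>x'<n. \<exists>y<n. \<exists>y'<n.
      (forced E A B x \<or> l = x \<or> m = x) \<and> (forced E A B x' \<or> l = x' \<or> m = x') \<and>
     (forced E B A y \<or> l = y + n \<or> m = y + n) \<and> (forced E B A y' \<or> l = y' + n \<or> m = y' + n) \<and>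
     (x = y \<or> (x, y) \<in> E \<and> (x', y') \<in> E \<and>
       (x \<noteq> x' \<and> (x, x') \<notin> E \<or> y \<noteq> y' \<and> (y, y') \<notin> E)))"
    unfolding conflict_fm_def side_fm_def neg_lit_def
    by (simp only: sat.simps sat_Dis sat_eq_fm val.simps v v' forced adj cong: conj_cong)
  then show ?thesis unfolding conflict_def .
qed

section \<open>Variable elimination on stored matrices\<close>

definition entry_fm :: "exp \<Rightarrow> exp \<Rightarrow> fm" where
  "entry_fm l m = Tst (Cell 6 (idx l m))"

definition weakened_fm :: "exp \<Rightarrow> exp \<Rightarrow> fm" where
  "weakened_fm l m = Dis (entry_fm l m) (Dis (entry_fm l l) (entry_fm m m))"

definition elim_fm :: fm where
  "elim_fm = Dis (entry_fm (V 8) (V 9)) (Dis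
     (Con (weakened_fm (V 8) (V 16)) (weakened_fm (neg_lit (V 16)) (V 9)))
     (Con (weakened_fm (V 8) (neg_lit (V 16))) (weakened_fm (V 16) (V 9))))"

definition copy_fm :: fm where "copy_fm = Tst (Cell 7 (idx (V 8) (V 9)))"

definition answer_fm :: fm where
  "answer_fm = Neg (Ex 10 (Con (entry_fm (V 10) (V 10)) (entry_fm (neg_lit (V 10)) (neg_lit (V 10)))))"

definition entry :: "nat \<Rightarrow> (nat \<Rightarrow> nat) \<Rightarrow> nat \<Rightarrow> nat \<Rightarrow> bool" where
  "entry n X l m \<longleftrightarrow> X (l * (2 * n) + m) \<noteq> 0"

lemma val_idx:
  assumes "row_offsets s" "val l s < 2 * s 0 0"
  shows "val (idx l m) s = val l s * (2 * s 0 0) + val m s"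
  using assms by (simp add: idx_def row_offsets_def)

lemma sat_entry_fm:
  "row_offsets s \<Longrightarrow> val l s < 2 * s 0 0 \<Longrightarrow>
     sat (entry_fm l m) s \<longleftrightarrow> entry (s 0 0) (s 6) (val l s) (val m s)"
  by (simp add: entry_fm_def entry_def val_idx)

lemma row_offsets_setv: "v \<noteq> 0 \<Longrightarrow> v \<noteq> 4 \<Longrightarrow> row_offsets (setv v x s) = row_offsets s"
  by (auto simp: row_offsets_def setv_apply)

lemma table_cong:
  assumes "\<And>l m. l < 2 * n \<Longrightarrow> m < 2 * n \<Longrightarrow> R l m = R' l m"
  shows "table n R X = table n R' X"
proof
  fix k
  have "R (k div (2 * n)) (k mod (2 * n)) = R' (k div (2 * n)) (k mod (2 * n))" if "k div (2 * n) < 2 * n"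
    using that by (intro assms) auto
  then show "table n R X k = table n R' X k" by (simp add: table_def)
qed

lemma entry_table:
  assumes "l < 2 * n" "m < 2 * n"
  shows "entry n (table n R X) l m = R l m"
proof -
  have "(l * (2 * n) + m) div (2 * n) = l" "(l * (2 * n) + m) mod (2 * n) = m" using assms by auto
  then show ?thesis using assms by (simp add: entry_def table_def)
qed

text \<open>For the copy from array 7 to array 6: where the arrays agree outside the matrix, copying
  its entries makes them equal.\<close>

lemma table_entry:
  "table n (entry n (table n R X)) X = table n R X"
  by (rule table_cong) (simp add: entry_table)

lemma sat_elim_fm:
  assumes "row_offsets s" "s 16 0 < s 0 0" "l < 2 * s 0 0" "m < 2 * s 0 0"
  shows "sat elim_fm (setv 9 m (setv 8 l s)) \<longleftrightarrow> elim_var (s 0 0) (s 16 0) (entry (s 0 0) (s 6)) l m"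
proof -
  let ?s = "setv 9 m (setv 8 l s)"
  have r: "row_offsets ?s" using assms(1) by (simp add: row_offsets_setv)
  have v: "?s 0 = s 0" "?s 16 = s 16" "?s 6 = s 6" "?s 8 0 = l" "?s 9 0 = m" by (simp_all add: setv_apply)
  have k: "s 16 0 < 2 * s 0 0" "s 16 0 + s 0 0 < 2 * s 0 0" using assms(2) by simp_all
  show ?thesis
    by (simp add: elim_fm_def weakened_fm_def elim_var_def weakened_def sat_entry_fm[OF r] neg_lit_def v k assms)
qed

lemma sat_copy_fm:
  assumes "row_offsets s" "l < 2 * s 0 0"
  shows "sat copy_fm (setv 9 m (setv 8 l s)) \<longleftrightarrow> entry (s 0 0) (s 7) l m"
proof -
  let ?s = "setv 9 m (setv 8 l s)"
  have r: "row_offsets ?s" using assms(1) by (simp add: row_offsets_setv)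
  have v: "?s 0 = s 0" "?s 7 = s 7" "?s 8 0 = l" "?s 9 0 = m" by (simp_all add: setv_apply)
  show ?thesis by (simp add: copy_fm_def val_idx[OF r] v assms entry_def)
qed

definition elim_step :: "nat \<Rightarrow> nat \<Rightarrow> (nat \<Rightarrow> nat) \<Rightarrow> nat \<Rightarrow> nat" where
  "elim_step n k X = table n (elim_var n k (entry n X)) X"

text \<open>For literals below \<open>2 * n\<close> an elimination step consults only such literals,
  so the stored matrix follows the abstract one on this range.\<close>

lemma entry_elim_steps:
  assumes "set ks \<subseteq> {..<n}" and X: "\<And>l m. l < 2 * n \<Longrightarrow> m < 2 * n \<Longrightarrow> entry n X l m = K l m"
    and "l < 2 * n" "m < 2 * n"
  shows "entry n (foldr (elim_step n) ks X) l m = elim_vars n ks K l m"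
  using assms(1,3,4)
proof (induction ks arbitrary: l m)
  case Nil then show ?case using X by (simp add: elim_vars_def)
next
  case (Cons k ks)
  then have IH: "entry n (foldr (elim_step n) ks X) l m = elim_vars n ks K l m"
    if "l < 2 * n" "m < 2 * n" for l m using that by simp
  define Y where "Y = foldr (elim_step n) ks X"
  have k: "k < 2 * n" "k + n < 2 * n" using Cons.prems(1) by simp_all
  have "elim_vars n (k # ks) K = elim_var n k (elim_vars n ks K)" by (simp add: elim_vars_def)
  moreover have "foldr (elim_step n) (k # ks) X = elim_step n k Y" by (simp add: Y_def)
  moreover have "entry n (elim_step n k Y) l m = elim_var n k (entry n Y) l m"
    using Cons.prems(2,3) by (simp add: elim_step_def entry_table)
  moreover have "\<dots> = elim_var n k (elim_vars n ks K) l m"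
    using Cons.prems(2,3) k by (simp add: elim_var_def weakened_def IH[folded Y_def])
  ultimately show ?case by (simp only:)
qed

text \<open>A matrix is not overwritten while it is read, hence the second array and the copy. The
  counter visits \<open>n - 1\<close> first and 0 last, in the order of \<open>foldr\<close> on
  \<open>[0..<n]\<close>.\<close>

definition elim_com :: com where
  "elim_com = For 16 (V 0) (Seq (tabulate 7 elim_fm) (tabulate 6 copy_fm))"

lemmas fm_defs = conflict_fm_def side_fm_def forced_fm_def neg_lit_def elim_fm_def weakened_fm_def
  entry_fm_def copy_fm_def answer_fm_def idx_def adj_fm_def eq_fm_def Dis_def

lemma runs_copy:
  "runs (\<lambda>s. row_offsets s \<and> zero_on {5, 8, 9} s) (tabulate 6 copy_fm)
     (\<lambda>s. s(6 := table (s 0 0) (entry (s 0 0) (s 7)) (s 6)))"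
proof (rule runs_cong[OF runs_tabulate])
  fix s :: state assume s: "row_offsets s \<and> zero_on {5, 8, 9} s"
  have "table (s 0 0) (\<lambda>l m. sat copy_fm (setv 9 m (setv 8 l s))) (s 6) =
      table (s 0 0) (entry (s 0 0) (s 7)) (s 6)"
    using s by (intro table_cong) (simp add: sat_copy_fm)
  then show "s(6 := table (s 0 0) (\<lambda>l m. sat copy_fm (setv 9 m (setv 8 l s))) (s 6)) =
      s(6 := table (s 0 0) (entry (s 0 0) (s 7)) (s 6))" by simp
qed (simp_all add: fm_defs)

text \<open>The equation \<open>s 7 = s 6\<close> belongs to the loop invariant, as it makes the
  arrays agree outside the matrix too.\<close>

lemma runs_elim_com:
  "runs (\<lambda>s. row_offsets s \<and> zero_on {5, 8, 9, 16} s \<and> s 7 = s 6) elim_com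
    (\<lambda>s. let X = foldr (elim_step (s 0 0)) [0..<s 0 0] (s 6) in s(6 := X, 7 := X))"
proof -
  let ?P = "\<lambda>s. row_offsets s \<and> zero_on {5, 8, 9} s \<and> s 7 = s 6 \<and> s 16 0 < s 0 0"
  let ?f = "\<lambda>s. let X = elim_step (s 0 0) (s 16 0) (s 6) in s(6 := X, 7 := X)"
  have 1: "runs ?P (tabulate 7 elim_fm) (\<lambda>s. s(7 := elim_step (s 0 0) (s 16 0) (s 6)))"
  proof (rule runs_cong[OF runs_tabulate])
    fix s :: state assume s: "?P s"
    have "table (s 0 0) (\<lambda>l m. sat elim_fm (setv 9 m (setv 8 l s))) (s 7) = elim_step (s 0 0) (s 16 0) (s 6)"
    proof -
      have "s 7 = s 6" using s by blast
      moreover have "table (s 0 0) (\<lambda>l m. sat elim_fm (setv 9 m (setv 8 l s))) X =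
          table (s 0 0) (elim_var (s 0 0) (s 16 0) (entry (s 0 0) (s 6))) X" for X
        using s by (intro table_cong) (simp add: sat_elim_fm)
      ultimately show ?thesis by (simp add: elim_step_def)
    qed
    then show "s(7 := table (s 0 0) (\<lambda>l m. sat elim_fm (setv 9 m (setv 8 l s))) (s 7)) =
        s(7 := elim_step (s 0 0) (s 16 0) (s 6))" by simp
  qed (simp_all add: fm_defs)
  have r: "row_offsets (s(a := X)) = row_offsets s" "zero_on {5, 8, 9} (s(a := X)) = zero_on {5, 8, 9} s"
    if "a = 6 \<or> a = 7" for s a X
    using that by (auto simp: row_offsets_def zero_on_def)
  have body: "runs ?P (Seq (tabulate 7 elim_fm) (tabulate 6 copy_fm)) ?f"
  proof (rule runs_cong[OF runs_Seq[OF 1 runs_copy]])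
    fix s :: state
    let ?s = "s(7 := elim_step (s 0 0) (s 16 0) (s 6))"
    have "table (s 0 0) (entry (s 0 0) (elim_step (s 0 0) (s 16 0) (s 6))) (s 6) = elim_step (s 0 0) (s 16 0) (s 6)"
      unfolding elim_step_def by (rule table_entry)
    then show "?s(6 := table (?s 0 0) (entry (?s 0 0) (?s 7)) (?s 6)) = ?f s"
      by (simp add: Let_def fun_upd_twist)
  qed (simp_all add: r)
  let ?I = "\<lambda>s. row_offsets s \<and> zero_on {5, 8, 9} s \<and> s 7 = s 6 \<and> s 16 0 \<le> s 0 0"
  \<comment> \<open>The variables below the counter are still to be eliminated.\<close>
  let ?g = "\<lambda>s. let X = foldr (elim_step (s 0 0)) [0..<s 16 0] (s 6) in setv 16 0 (s(6 := X, 7 := X))"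
  have "runs (\<lambda>s. row_offsets s \<and> zero_on {5, 8, 9, 16} s \<and> s 7 = s 6) elim_com
    (\<lambda>s. ?g (setv 16 (val (V 0) s) s))"
    unfolding elim_com_def
  proof (rule runs_For[OF body, where q = "[:0, 1:]" and I = ?I])
    fix s :: state and i assume I: "?I s" and i: "s 16 0 = Suc i"
    let ?X = "elim_step (s 0 0) i (s 6)"
    have f: "?f (setv 16 i s) = setv 16 i (s(6 := ?X, 7 := ?X))"
      by (auto simp: setv_def fun_eq_iff Let_def)
    have a: "setv 16 i s a = s a" if "a \<noteq> 16" for i s a using that by (simp add: setv_apply)
    have z: "zero_on {5, 8, 9} (setv 16 i s) = zero_on {5, 8, 9} s" for s by (simp add: zero_on_setv)
    have r': "row_offsets (setv 16 i s) = row_offsets s" for s by (simp add: row_offsets_setv)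
    have 1: "?P (setv 16 i s)" using I i by (simp add: z r' a) (simp add: setv_apply)
    have v: "setv 16 i (s(6 := ?X, 7 := ?X)) 16 0 = i" by (simp add: setv_apply)
    have 2: "?I (?f (setv 16 i s))" unfolding f using I i by (simp add: z r' a r v)
    have "?g (?f (setv 16 i s)) = ?g s"
      unfolding f Let_def v by (simp add: a i) (auto simp: setv_def fun_eq_iff)
    with 1 2 show "?P (setv 16 i s) \<and> ?I (?f (setv 16 i s)) \<and> ?f (setv 16 i s) 16 0 \<le> i \<and>
      ?f (setv 16 i s) 0 0 = s 0 0 \<and> ?g (?f (setv 16 i s)) = ?g s"
      unfolding f by (simp add: v a)
  next
    show "?g s = s" if "?I s" "s 16 0 = 0" for s
      using that by (auto simp: setv_def fun_eq_iff Let_def)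
  qed (simp_all add: setv_apply row_offsets_setv zero_on_def)
  then show ?thesis
  proof (rule runs_cong)
    fix s :: state assume s: "row_offsets s \<and> zero_on {5, 8, 9, 16} s \<and> s 7 = s 6"
    then have "s 16 0 = 0" by (simp add: zero_on_def)
    then have "setv 16 0 ((setv 16 i s)(6 := X, 7 := X)) = s(6 := X, 7 := X)" for i X
      by (auto simp: setv_def fun_eq_iff)
    then show "?g (setv 16 (val (V 0) s) s) =
        (let X = foldr (elim_step (s 0 0)) [0..<s 0 0] (s 6) in s(6 := X, 7 := X))"
      by (simp add: Let_def setv_apply)
  qed simp
qed

section \<open>The complete program and the correctness of its answer\<close>

definition decide_com :: com where
  "decide_com = Seq (Seq (Seq (Seq (Seq init_com (tabulate 7 conflict_fm)) (tabulate 6 copy_fm)) elim_com)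
     (compile answer_fm)) (Assign 0 (Const 0) (V 5))"

definition conflict_table :: "state \<Rightarrow> nat \<Rightarrow> nat" where
  "conflict_table s = table (s 0 0)
     (\<lambda>l m. sat conflict_fm (setv 9 m (setv 8 l (s(4 := offsets (s 0 0)))))) (\<lambda>_. 0)"

definition final_table :: "state \<Rightarrow> nat \<Rightarrow> nat" where
  "final_table s = foldr (elim_step (s 0 0)) [0..<s 0 0] (conflict_table s)"

definition final_state :: "state \<Rightarrow> state" where
  "final_state s = s(4 := offsets (s 0 0), 6 := final_table s, 7 := final_table s)"

text \<open>The answer overwrites the number of vertices in cell 0 of array 0, so it is written only
  after all parts whose time bounds refer to that cell.\<close>

lemma runs_decide_com:
  "runs (\<lambda>s. \<forall>a>3. s a = (\<lambda>_. 0)) decide_com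
    (\<lambda>s. setv 0 (of_bool (sat answer_fm (final_state s)))
      (setv 5 (of_bool (sat answer_fm (final_state s))) (final_state s)))"
proof -
  let ?P = "\<lambda>s :: state. \<forall>a>3. s a = (\<lambda>_. 0)"
  let ?off = "\<lambda>s. s(4 := offsets (s 0 0))"
  have ro: "row_offsets (?off s)" "row_offsets ((?off s)(7 := X))"
    "row_offsets ((?off s)(7 := X, 6 := Y))" for s X Y
    by (simp_all add: row_offsets_def offsets_def)
  have 1: "runs ?P init_com ?off"
    by (rule runs_cong[OF runs_init_com]) auto
  have t: "runs (\<lambda>s. row_offsets s \<and> zero_on {5, 8, 9, 10, 11, 12, 13, 14, 15} s) (tabulate 7 conflict_fm)
     (\<lambda>s. s(7 := table (s 0 0) (\<lambda>l m. sat conflict_fm (setv 9 m (setv 8 l s))) (s 7)))"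
    by (rule runs_cong[OF runs_tabulate]) (auto simp: fm_defs zero_on_def)
  have 2: "runs ?P (Seq init_com (tabulate 7 conflict_fm)) (\<lambda>s. (?off s)(7 := conflict_table s))"
    by (rule runs_cong[OF runs_Seq[OF 1 t]]) (auto simp: ro zero_on_def conflict_table_def)
  have 3: "runs ?P (Seq (Seq init_com (tabulate 7 conflict_fm)) (tabulate 6 copy_fm))
      (\<lambda>s. (?off s)(7 := conflict_table s, 6 := conflict_table s))"
  proof (rule runs_cong[OF runs_Seq[OF 2 runs_copy]])
    fix s :: state assume "?P s"
    moreover have "table (s 0 0) (entry (s 0 0) (conflict_table s)) (\<lambda>_. 0) = conflict_table s"
      unfolding conflict_table_def by (rule table_entry)
    ultimately show "((?off s)(7 := conflict_table s))(6 := table (((?off s)(7 := conflict_table s)) 0 0)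
       (entry (((?off s)(7 := conflict_table s)) 0 0) (((?off s)(7 := conflict_table s)) 7))
         (((?off s)(7 := conflict_table s)) 6)) = (?off s)(7 := conflict_table s, 6 := conflict_table s)"
      by simp
  qed (auto simp: ro zero_on_def)
  have 4: "runs ?P (Seq (Seq (Seq init_com (tabulate 7 conflict_fm)) (tabulate 6 copy_fm)) elim_com) final_state"
    by (rule runs_cong[OF runs_Seq[OF 3 runs_elim_com]])
      (auto simp: ro zero_on_def final_state_def final_table_def Let_def fun_eq_iff)
  have wa: "wf_fm answer_fm" "bound_vars answer_fm = {10}" by (simp_all add: fm_defs)
  have 5: "runs ?P (Seq (Seq (Seq (Seq init_com (tabulate 7 conflict_fm)) (tabulate 6 copy_fm)) elim_com)
     (compile answer_fm)) (\<lambda>s. setv 5 (of_bool (sat answer_fm (final_state s))) (final_state s))"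
    by (rule runs_Seq[OF 4 runs_compile[OF wa(1)]]) (auto simp: wa zero_on_def final_state_def)
  show ?thesis unfolding decide_com_def
    by (rule runs_cong[OF runs_Seq[OF 5 runs_setv[of "\<lambda>_. True"]]])
      (simp_all add: setv_apply final_state_def)
qed

text \<open>The stored matrix agrees with the abstract elimination of all variables, and
  \<open>answer_fm\<close> says that it contains no opposite unit clauses.\<close>

lemma sat_answer_final_state:
  assumes s: "holds_instance n E A B (s(4 := offsets (s 0 0)))" and AB: "A \<subseteq> {..<n}" "B \<subseteq> {..<n}"
  shows "sat answer_fm (final_state s) \<longleftrightarrow> (\<exists>h. avoids n n (conflict n E A B) h)"
proof -
  have n: "s 0 0 = n" using s by (simp add: holds_instance_def)
  have "entry n (conflict_table s) l m = conflict n E A B l m" if "l < 2 * n" "m < 2 * n" for l m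
    using that sat_conflict_fm[OF s AB] by (simp add: conflict_table_def n entry_table)
  then have X: "entry n (final_table s) l m = elim_vars n [0..<n] (conflict n E A B) l m"
    if "l < 2 * n" "m < 2 * n" for l m
    unfolding final_table_def n using that by (intro entry_elim_steps) auto
  let ?s = "\<lambda>v. setv 10 v (final_state s)"
  have r: "row_offsets (?s v)" for v
    by (simp add: row_offsets_setv) (simp add: row_offsets_def final_state_def offsets_def)
  have v: "?s v 0 0 = n" "?s v 6 = final_table s" "?s v 10 0 = v" "final_state s 0 0 = n" for v
    by (simp_all add: setv_apply final_state_def n)
  have "sat answer_fm (final_state s) \<longleftrightarrow>
      \<not> (\<exists>v<n. entry n (final_table s) v v \<and> entry n (final_table s) (v + n) (v + n))"
    by (auto simp: answer_fm_def sat_entry_fm[OF r] neg_lit_def v)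
  also have "\<dots> \<longleftrightarrow> \<not> (\<exists>v<n. elim_vars n [0..<n] (conflict n E A B) v v \<and>
      elim_vars n [0..<n] (conflict n E A B) (v + n) (v + n))"
    using X by auto
  also have "\<dots> \<longleftrightarrow> (\<exists>h. avoids n n (conflict n E A B) h)"
    by (rule avoids_iff_elim_vars[OF symp_conflict, symmetric])
  finally show ?thesis .
qed

lemma holds_instance_encode:
  fixes G A B defines "n \<equiv> card (pverts G)" and "s \<equiv> encode (G, A, B)"
  shows "holds_instance n (parcs G) A B (s(4 := offsets (s 0 0)))"
proof -
  have s: "s 0 = (\<lambda>i. if i = 0 then n else 0)"
    "s 1 = (\<lambda>i. of_bool (i < n * n \<and> (i div n, i mod n) \<in> parcs G))"
    "s 2 = (\<lambda>i. of_bool (i \<in> A))" "s 3 = (\<lambda>i. of_bool (i \<in> B))"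
    unfolding s_def n_def by (simp_all add: Let_def)
  \<comment> \<open>\<open>encode\<close> tests \<open>i < n * n\<close> as well, so matrix
    positions have to be shown to pass this test.\<close>
  have [simp]: "x * n + y < n * n" if "x < n" "y < n" for x y
  proof -
    have "x * n + y < Suc x * n" using that by simp
    also have "\<dots> \<le> n * n" using that by (intro mult_le_mono1) simp
    finally show ?thesis .
  qed
  show ?thesis
    by (simp add: holds_instance_def s row_offsets_def offsets_def del: One_nat_def)
qed

text \<open>Coefficients are natural numbers. This passes from the number of vertices, which bounds
  the time, to the size of the graph.\<close>

lemma poly_mono_nat:
  fixes p :: "nat poly"
  assumes "x \<le> y"
  shows "poly p x \<le> poly p y"
  using assms by (induction p) (auto intro: add_mono mult_mono)

theorem theorem26:
  shows "poly_time_decidable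
    (\<lambda>(G, A, B). graph_size G)
    encode
    (\<lambda>(G, A, B). pair_graph G \<and> numbered G \<and> Digraph_Component.connected (with_proj G) \<and>
       A \<subseteq> pverts G \<and> B \<subseteq> pverts G \<and> A \<inter> B = {} \<and> linked G A B \<and> saturated G A B)
    (\<lambda>(G, A, B). separated_by_half_spaces G A B)"
proof -
  let ?f = "\<lambda>s. setv 0 (of_bool (sat answer_fm (final_state s)))
      (setv 5 (of_bool (sat answer_fm (final_state s))) (final_state s))"
  \<comment> \<open>The program and the polynomial are fixed before any instance is
    considered.\<close>
  obtain p :: "nat poly" where p: "\<And>s. \<forall>a>3. s a = (\<lambda>_. 0) \<Longrightarrow>
      \<exists>t. exec decide_com s t (?f s) \<and> t \<le> poly p (s 0 0)"
    using runs_decide_com unfolding runs_def by blast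
  have main: "\<exists>t s. exec decide_com (encode (G, A, B)) t s \<and> t \<le> poly p (graph_size G) \<and>
      (s 0 0 \<noteq> 0 \<longleftrightarrow> separated_by_half_spaces G A B)"
    if G: "pair_graph G" and num: "numbered G" and conn: "Digraph_Component.connected (with_proj G)"
      and AB: "A \<subseteq> pverts G" "B \<subseteq> pverts G" and link: "linked G A B" for G A B
  proof -
    let ?s = "encode (G, A, B)" and ?n = "card (pverts G)"
    have V: "pverts G = {..<?n}" using num by (simp add: numbered_def)
    obtain t where t: "exec decide_com ?s t (?f ?s)" "t \<le> poly p (?s 0 0)"
      using p[of ?s] by (auto simp: Let_def)
    have "?s 0 0 \<le> graph_size G" by (simp add: graph_size_def Let_def)
    then have "t \<le> poly p (graph_size G)" using t(2) poly_mono_nat le_trans by blast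
    moreover have "sat answer_fm (final_state ?s) \<longleftrightarrow> separated_by_half_spaces G A B"
      unfolding separated_iff_avoids[OF G conn V AB link]
      by (rule sat_answer_final_state[OF holds_instance_encode]) (use AB V in auto)
    ultimately show ?thesis
      using t(1) by (intro exI[of _ t] exI[of _ "?f ?s"]) (simp add: setv_apply)
  qed
  show ?thesis
    unfolding poly_time_decidable_def
    by (intro exI[of _ decide_com] exI[of _ p])
      (simp only: split_paired_All case_prod_conv, intro allI impI, elim conjE, rule main)
qed

end
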